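(* Let $\mu\in\mathbb R$, let $B^\mu$ be a Brownian motion with drift $\mu$ started at $0$, let $t>0$, and let ${}^{\mu}T_{0,t}=\sup\{s<t:B^\mu(s)=0\}$ and ${}^{\mu}T_{t,0}=\inf\{s>t:B^\mu(s)=0\}$. Then for $0<a<t<b<\infty$, $$P({}^{\mu}T_{0,t}<a,\ {}^{\mu}T_{t,0}>b)=1-\frac1\pi\int_0^{b-a}\frac{1}{a+s}\sqrt{\frac as}\,e^{-\frac{\mu^2}{2}(a+s)}\,ds ,$$ and on the region $0<a<t<b<\infty$ the vector $({}^{\mu}T_{0,t},{}^{\mu}T_{t,0})$ admits the joint density $$\frac{P({}^{\mu}T_{0,t}\in da,\ {}^{\mu}T_{t,0}\in db)}{da\,db}=\frac{e^{-\frac{\mu^2}{2}b}}{2\pi\sqrt{a(b-a)^3}} .$$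
   Context: A Brownian motion with drift $\mu$ started at $0$ is $B^\mu(s)=B(s)+\mu s$, $s\ge 0$, with $B$ a standard one-dimensional Brownian motion, $B(0)=0$. The supremum is over $s\in[0,t)$. The convention $\inf\emptyset=+\infty$ is used, so ${}^{\mu}T_{t,0}$ may equal $+\infty$ with positive probability; the joint density describes the law of $({}^{\mu}T_{0,t},{}^{\mu}T_{t,0})$ restricted to $\{{}^{\mu}T_{t,0}<\infty\}$. *)

theory Defs
  imports "HOL-Probability.Probability"
begin

text \<open>
  Time is indexed by \<^typ>\<open>real\<close>; only the values \<open>B s\<close> with \<open>s \<ge> 0\<close> are constrained.
  The starting point and the continuity of paths are required for every outcome, so that
  the events below are measurable without completing the probability space.
\<close>

locale standard_brownian_motion = prob_space M for M :: "'a measure" +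
  fixes B :: "real \<Rightarrow> 'a \<Rightarrow> real"
  assumes rv: "0 \<le> s \<Longrightarrow> random_variable borel (B s)"
    and start: "\<omega> \<in> space M \<Longrightarrow> B 0 \<omega> = 0"
    and indep_increments:
      "\<lbrakk>0 \<le> \<tau> 0; mono_on {..n} \<tau>\<rbrakk> \<Longrightarrow>
        indep_vars (\<lambda>_. borel) (\<lambda>i \<omega>. B (\<tau> (Suc i)) \<omega> - B (\<tau> i) \<omega>) {..<n::nat}"
    and normal_increments:
      "\<lbrakk>0 \<le> s; s < u\<rbrakk> \<Longrightarrow>
        distributed M lborel (\<lambda>\<omega>. B u \<omega> - B s \<omega>) (normal_density 0 (sqrt (u - s)))"
    and continuous_paths: "\<omega> \<in> space M \<Longrightarrow> continuous_on {0..} (\<lambda>s. B s \<omega>)"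

definition with_drift :: "real \<Rightarrow> (real \<Rightarrow> 'a \<Rightarrow> real) \<Rightarrow> real \<Rightarrow> 'a \<Rightarrow> real" where
  "with_drift \<mu> B s \<omega> = B s \<omega> + \<mu> * s"

text \<open>
  The set below contains \<open>0\<close> whenever \<open>X 0 \<omega> = 0\<close> and \<open>t > 0\<close>, and it is bounded by \<open>t\<close>,
  so the real-valued supremum is the genuine one.
\<close>

definition last_zero_before :: "(real \<Rightarrow> 'a \<Rightarrow> real) \<Rightarrow> real \<Rightarrow> 'a \<Rightarrow> real" where
  "last_zero_before X t \<omega> = Sup {s. 0 \<le> s \<and> s < t \<and> X s \<omega> = 0}"

text \<open>In \<^typ>\<open>ereal\<close> the infimum of the empty set is \<open>\<infinity>\<close>.\<close>

definition first_zero_after :: "(real \<Rightarrow> 'a \<Rightarrow> real) \<Rightarrow> real \<Rightarrow> 'a \<Rightarrow> ereal" where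
  "first_zero_after X t \<omega> = Inf {ereal s |s. t < s \<and> X s \<omega> = 0}"

text \<open>
  The second component \<open>V\<close> may be infinite. On the region \<open>R\<close> of the plane, the law of
  \<open>(U, V)\<close> restricted to \<open>{\<bar>V\<bar> < \<infinity>}\<close> has density \<open>f\<close> with respect to two-dimensional
  Lebesgue measure. Nothing is asserted about the law outside \<open>R\<close>, where it may have
  further mass.
\<close>

definition has_joint_density_on ::
  "'a measure \<Rightarrow> ('a \<Rightarrow> real) \<Rightarrow> ('a \<Rightarrow> ereal) \<Rightarrow> (real \<times> real) set \<Rightarrow> (real \<Rightarrow> real \<Rightarrow> real) \<Rightarrow> bool"
where
  "has_joint_density_on M U V R f \<longleftrightarrow>
     U \<in> borel_measurable M \<and> V \<in> borel_measurable M \<and>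
     (\<lambda>(x, y). f x y) \<in> borel_measurable (restrict_space borel R) \<and>
     (\<forall>(x, y)\<in>R. 0 \<le> f x y) \<and>
     (\<forall>A\<in>sets (borel :: (real \<times> real) measure). A \<subseteq> R \<longrightarrow>
        emeasure M {\<omega> \<in> space M. \<bar>V \<omega>\<bar> < \<infinity> \<and> (U \<omega>, real_of_ereal (V \<omega>)) \<in> A} =
        (\<integral>\<^sup>+(x, y)\<in>A. ennreal (f x y) \<partial>lborel))"

end

theory Submission
  imports Defs "HOL-Real_Asymp.Real_Asymp"
begin

text \<open>
  Off the null event \<open>X t = 0\<close>, the event \<open>{T\<^sub>0\<^sub>,\<^sub>t < a, T\<^sub>t\<^sub>,\<^sub>0 > b}\<close> says that the path \<open>X\<close> has no
  zero in \<open>{a..b}\<close>. The explicit probability \<open>u s x\<close> that the drifted motion started at \<open>x > 0\<close> stays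
  positive up to time \<open>s\<close> extends to a space-time harmonic function on the whole line which is
  nonpositive for \<open>x \<le> 0\<close>. Hence \<open>u (b - s) (X s)\<close>, stopped when \<open>X\<close> is first observed nonpositive
  on a finite time grid, bounds the probability of staying positive on the grid from below; with
  \<open>u (b - s) (X s + \<epsilon>)\<close> one gets an upper bound up to steps longer than \<open>\<epsilon>\<close>, whose total probability
  vanishes as the grid is refined. This avoids the strong Markov property. Averaging \<open>u\<close> over
  \<open>X a\<close> gives the integral formula for the positive side, and \<open>- B\<close> with drift \<open>- \<mu>\<close> gives the
  negative side. The density is the mixed derivative of that formula, identified on rectangles.
\<close>

section \<open>The survival function\<close>

text \<open>The formula for \<open>survival\<close> comes from the method of images: the mirror
  source carries the weight \<open>exp (- 2 * \<mu> * x)\<close>, and \<open>survival \<mu> s (- x)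
  = - exp (2 * \<mu> * x) * survival \<mu> s x\<close>, so the function vanishes at
  \<open>x = 0\<close> and changes sign there. The price of the continuation is exponential growth
  on the negative half-line when \<mu> > 0; hence a long step across zero has to be controlled by an
  exponential moment, not merely by a small probability.

  The locale gives independent increments along finite partitions and no filtration, so all
  conditioning involves finitely many times, and continuity of paths enters only when the grid is
  refined. Since \<open>survival\<close> is a difference, its two terms are treated separately as
  nonnegative integrals; most identities are stated as sums in \<open>ennreal\<close>, where
  cancelling needs only finiteness.

  For \<mu> \<noteq> 0 the value \<open>X a\<close> is not symmetric, yet both sides of zero lose
  the same mass to paths that hit zero, because that mass depends on \<mu> only through
  \<open>\<mu>\<^sup>2\<close>.\<close>

definition Phi :: "real \<Rightarrow> real" where
  "Phi = cdf std_normal_distribution"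

lemma prob_space_std_normal: "prob_space std_normal_distribution"
  by (rule prob_space_normal_density) simp

lemma Phi_nonneg: "0 \<le> Phi z" and Phi_le_1: "Phi z \<le> 1"
  using prob_space.prob_le_1[OF prob_space_std_normal] by (auto simp: Phi_def cdf_def)

lemma Phi_at_top: "(Phi \<longlongrightarrow> 1) at_top"
  unfolding Phi_def
  using real_distribution.cdf_lim_at_top_prob[OF real_dist_normal_dist] .

lemma Phi_at_bot: "(Phi \<longlongrightarrow> 0) at_bot"
  unfolding Phi_def
  by (intro finite_borel_measure.cdf_lim_at_bot real_distribution.finite_borel_measure_M
      real_dist_normal_dist)

lemma ennreal_Phi:
  "ennreal (Phi z) = (\<integral>\<^sup>+v. ennreal (std_normal_density v) * indicator {..z} v \<partial>lborel)"
proof -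
  interpret prob_space std_normal_distribution by (rule prob_space_std_normal)
  show ?thesis
    unfolding Phi_def cdf_def by (simp add: emeasure_eq_measure[symmetric] emeasure_density)
qed

text \<open>The primitive is anchored at \<open>z - 1\<close> so that only the fundamental theorem
  on a compact interval is needed; it agrees with \<open>Phi\<close> on an open neighbourhood of
  \<open>z\<close>, which suffices for the derivative.\<close>

lemma DERIV_Phi: "(Phi has_real_derivative std_normal_density z) (at z)"
proof -
  interpret prob_space std_normal_distribution by (rule prob_space_std_normal)
  have int: "set_integrable lborel {z - 1..z + 1} std_normal_density"
    unfolding set_integrable_def by (intro integrable_mult_indicator) auto
  have cont: "continuous_on {z - 1..z + 1} std_normal_density"
    unfolding normal_density_def by (intro continuous_intros) auto
  have "((\<lambda>x. Phi (z - 1) + integral {z - 1..x} std_normal_density)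
      has_real_derivative 0 + std_normal_density z) (at z within {z - 1..z + 1})"
    by (intro DERIV_add integral_has_real_derivative cont) auto
  then have D: "((\<lambda>x. Phi (z - 1) + integral {z - 1..x} std_normal_density)
      has_real_derivative std_normal_density z) (at z)"
    using at_within_Icc_at[of "z - 1" z "z + 1"] by simp
  have eq: "Phi (z - 1) + integral {z - 1..x} std_normal_density = Phi x"
    if x: "x \<in> {z - 1<..<z + 1}" for x
  proof -
    have si: "set_integrable lborel {z - 1..x} std_normal_density"
      by (rule set_integrable_subset[OF int]) (use x in auto)
    have "Phi x - Phi (z - 1) = measure std_normal_distribution {z - 1<..x}"
      unfolding Phi_def using x
      by (intro finite_borel_measure.cdf_diff_eq real_distribution.finite_borel_measure_M
          real_dist_normal_dist) auto
    also have "ennreal \<dots> = (\<integral>\<^sup>+v. ennreal (std_normal_density v) * indicator {z - 1<..x} v \<partial>lborel)"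
      by (simp add: emeasure_eq_measure[symmetric] emeasure_density)
    also have "\<dots> = (\<integral>\<^sup>+v. ennreal (indicator {z - 1..x} v * std_normal_density v) \<partial>lborel)"
      by (intro nn_integral_cong_AE)
         (use AE_lborel_singleton[of "z - 1"] in \<open>eventually_elim, auto simp: indicator_def\<close>)
    also have "\<dots> = ennreal (LINT v:{z - 1..x}|lborel. std_normal_density v)"
      using si unfolding set_integrable_def set_lebesgue_integral_def
      by (subst nn_integral_eq_integral) (auto simp: indicator_def)
    also have "(LINT v:{z - 1..x}|lborel. std_normal_density v) = integral {z - 1..x} std_normal_density"
      by (rule set_borel_integral_eq_integral(2)[OF si])
    finally have "ennreal (Phi x - Phi (z - 1)) = ennreal (integral {z - 1..x} std_normal_density)"
      by simp
    moreover have "Phi (z - 1) \<le> Phi x"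
      unfolding Phi_def cdf_def using x by (intro finite_measure_mono) auto
    moreover have "0 \<le> integral {z - 1..x} std_normal_density"
      using set_borel_integral_eq_integral(1)[OF si] by (intro integral_nonneg) auto
    ultimately show ?thesis by simp
  qed
  show ?thesis
    by (rule has_field_derivative_transform_within_open[OF D, of "{z - 1<..<z + 1}"]) (use eq in auto)
qed

lemma isCont_Phi: "isCont Phi z"
  using DERIV_Phi DERIV_isCont by blast

lemma continuous_on_Phi[continuous_intros]:
  "continuous_on S f \<Longrightarrow> continuous_on S (\<lambda>x. Phi (f x))"
  using continuous_on_compose2[OF continuous_at_imp_continuous_on[of UNIV Phi]] isCont_Phi by auto

lemma borel_measurable_Phi[measurable]: "Phi \<in> borel_measurable borel"
  by (intro borel_measurable_continuous_onI continuous_on_Phi continuous_on_id)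

text \<open>The probability that \<open>c + W\<close> is positive when \<open>W\<close> is centred normal with variance \<open>s\<close>;
  the case \<open>s = 0\<close> has to be split off because \<open>c / 0 = 0\<close>.\<close>

definition psi :: "real \<Rightarrow> real \<Rightarrow> real" where
  "psi s c = (if s = 0 then indicator {0<..} c else Phi (c / sqrt s))"

lemma psi_nonneg: "0 \<le> psi s c" and psi_le_1: "psi s c \<le> 1"
  by (auto simp: psi_def Phi_nonneg Phi_le_1)

lemma borel_measurable_psi[measurable]: "psi s \<in> borel_measurable borel"
  unfolding psi_def[abs_def] by (cases "s = 0") auto

lemma ennreal_psi:
  assumes s: "0 < s"
  shows "ennreal (psi s c) =
    (\<integral>\<^sup>+w. ennreal (normal_density 0 (sqrt s) w) * indicator {0<..} (c + w) \<partial>lborel)"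
proof -
  \<comment> \<open>The substitution \<open>w = - sqrt s * v\<close> has a negative factor: it turns
    the upper tail \<open>c + w > 0\<close> into the lower tail \<open>v < c / sqrt s\<close> that
    \<open>Phi\<close> measures.\<close>
  have "(\<integral>\<^sup>+w. ennreal (normal_density 0 (sqrt s) w) * indicator {0<..} (c + w) \<partial>lborel)
      = ennreal (sqrt s) * (\<integral>\<^sup>+v. ennreal (normal_density 0 (sqrt s) (0 + (- sqrt s) * v)) *
          indicator {0<..} (c + (0 + (- sqrt s) * v)) \<partial>lborel)"
    using s by (subst nn_integral_real_affine[where c = "- sqrt s" and t = 0]) auto
  also have "\<dots> = (\<integral>\<^sup>+v. ennreal (sqrt s) * (ennreal (normal_density 0 (sqrt s) (0 + (- sqrt s) * v)) *
          indicator {0<..} (c + (0 + (- sqrt s) * v))) \<partial>lborel)"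
    by (subst nn_integral_cmult) auto
  also have "\<dots> = (\<integral>\<^sup>+v. ennreal (std_normal_density v) * indicator {..c / sqrt s} v \<partial>lborel)"
  proof (rule nn_integral_cong_AE)
    have dens: "ennreal (sqrt s) * ennreal (normal_density 0 (sqrt s) (0 + (- sqrt s) * v)) = ennreal (std_normal_density v)" for v
      using s by (simp add: ennreal_mult[symmetric] normal_density_def power_mult_distrib real_sqrt_mult)
    have ind: "indicator {0<..} (c + (0 + (- sqrt s) * v)) = (indicator {..c / sqrt s} v :: ennreal)"
      if "v \<noteq> c / sqrt s" for v
      using s that by (auto simp: indicator_def field_simps)
    show "AE v in lborel. ennreal (sqrt s) * (ennreal (normal_density 0 (sqrt s) (0 + (- sqrt s) * v)) *
          indicator {0<..} (c + (0 + (- sqrt s) * v))) = ennreal (std_normal_density v) * indicator {..c / sqrt s} v"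
      by (rule AE_mp[OF AE_lborel_singleton[of "c / sqrt s"]], rule AE_I2, rule impI)
         (simp only: mult.assoc[symmetric] dens ind not_False_eq_True)
  qed
  finally show ?thesis using s by (simp add: psi_def ennreal_Phi)
qed

text \<open>Moving the dependence on \<open>c\<close> from the domain into the Gaussian puts both
  terms of \<open>survival\<close> over the same half-line, where their integrands can be compared
  pointwise.\<close>

lemma ennreal_psi_shift:
  assumes s: "0 < s"
  shows "ennreal (psi s c) =
    (\<integral>\<^sup>+w. ennreal (std_normal_density (w - c / sqrt s)) * indicator {0..} w \<partial>lborel)"
proof -
  have "ennreal (psi s c) = (\<integral>\<^sup>+v. ennreal (std_normal_density v) * indicator {..c / sqrt s} v \<partial>lborel)"
    using s by (simp add: psi_def ennreal_Phi)
  also have "\<dots> = (\<integral>\<^sup>+w. ennreal (std_normal_density (c / sqrt s + (-1) * w)) *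
      indicator {..c / sqrt s} (c / sqrt s + (-1) * w) \<partial>lborel)"
    by (subst nn_integral_real_affine[where c = "-1" and t = "c / sqrt s"]) auto
  also have "\<dots> = (\<integral>\<^sup>+w. ennreal (std_normal_density (w - c / sqrt s)) * indicator {0..} w \<partial>lborel)"
    by (intro nn_integral_cong) (auto simp: normal_density_def indicator_def power2_commute)
  finally show ?thesis .
qed

text \<open>Semigroup property: the sum of independent centred normals with variances
  \<open>h\<close> and \<open>s\<close> has variance \<open>s + h\<close>. For \<open>s = 0\<close>
  this is the integral representation of \<open>psi\<close> itself.\<close>

lemma psi_step:
  assumes s: "0 \<le> s" and h: "0 < h"
  shows "(\<integral>\<^sup>+d. ennreal (normal_density 0 (sqrt h) d) * ennreal (psi s (c + d)) \<partial>lborel) = ennreal (psi (s + h) c)"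
proof (cases "s = 0")
  case True
  have "ennreal (psi s (c + d)) = indicator {0<..} (c + d)" for d
    using True by (auto simp: psi_def indicator_def)
  then show ?thesis using True h by (simp add: ennreal_psi)
next
  case False
  with s have s: "0 < s" by simp
  let ?N = "\<lambda>v w. ennreal (normal_density 0 (sqrt v) w)"
  have shift: "(\<integral>\<^sup>+w. ?N s w * indicator {0<..} (c + d + w) \<partial>lborel) =
      (\<integral>\<^sup>+w. ?N s (- d + 1 * w) * indicator {0<..} (c + d + (- d + 1 * w)) \<partial>lborel)" for d
    by (subst nn_integral_real_affine[where c = 1 and t = "- d"]) auto
  have "(\<integral>\<^sup>+d. ?N h d * ennreal (psi s (c + d)) \<partial>lborel)
     = (\<integral>\<^sup>+d. ?N h d * (\<integral>\<^sup>+w. ?N s (- d + 1 * w) * indicator {0<..} (c + d + (- d + 1 * w)) \<partial>lborel) \<partial>lborel)"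
    unfolding ennreal_psi[OF s]
    by (intro nn_integral_cong arg_cong2[where f = "(*)"] refl shift)
  also have "\<dots> = (\<integral>\<^sup>+d. (\<integral>\<^sup>+w. ?N h d * (?N s (w - d) * indicator {0<..} (c + w)) \<partial>lborel) \<partial>lborel)"
    by (subst nn_integral_cmult) (auto simp: algebra_simps)
  also have "\<dots> = (\<integral>\<^sup>+w. (\<integral>\<^sup>+d. ?N h d * (?N s (w - d) * indicator {0<..} (c + w)) \<partial>lborel) \<partial>lborel)"
    by (rule lborel_pair.Fubini') measurable
  also have "\<dots> = (\<integral>\<^sup>+w. (\<integral>\<^sup>+d. ennreal (normal_density 0 (sqrt s) (w - d) * normal_density 0 (sqrt h) d) \<partial>lborel)
      * indicator {0<..} (c + w) \<partial>lborel)"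
    by (intro nn_integral_cong, subst nn_integral_multc[symmetric])
       (auto simp: ennreal_mult' mult_ac)
  also have "\<dots> = (\<integral>\<^sup>+w. ?N (s + h) w * indicator {0<..} (c + w) \<partial>lborel)"
    using s h by (subst fun_cong[OF conv_normal_density_zero_mean]) auto
  finally show ?thesis using s h by (simp add: ennreal_psi)
qed

text \<open>For \<open>x > 0\<close> this is the probability that Brownian motion with drift \<open>\<mu>\<close> started at \<open>x\<close>
  does not hit \<open>0\<close> before time \<open>s\<close>. The formula continues it to a space-time harmonic function
  on the whole line, which is nonpositive on the negative half-line.\<close>

definition survival :: "real \<Rightarrow> real \<Rightarrow> real \<Rightarrow> real" where
  "survival \<mu> s x = psi s (x + \<mu> * s) - exp (- 2 * \<mu> * x) * psi s (\<mu> * s - x)"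

lemma borel_measurable_survival[measurable]: "survival \<mu> s \<in> borel_measurable borel"
  unfolding survival_def[abs_def] by measurable

lemma survival_le_1: "survival \<mu> s x \<le> 1"
  using psi_le_1[of s "x + \<mu> * s"] mult_nonneg_nonneg[OF exp_ge_zero psi_nonneg, of "- 2 * \<mu> * x" s "\<mu> * s - x"]
  unfolding survival_def by linarith

text \<open>Limits the loss when a step jumps far below zero; the exponent here is what the Chernoff
  estimate for long steps must absorb.\<close>

lemma survival_ge: "- exp (- 2 * \<mu> * x) \<le> survival \<mu> s x"
proof -
  have "exp (- 2 * \<mu> * x) * psi s (\<mu> * s - x) \<le> exp (- 2 * \<mu> * x) * 1"
    by (intro mult_left_mono psi_le_1) auto
  then show ?thesis using psi_nonneg[of s "x + \<mu> * s"] unfolding survival_def by linarith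
qed

text \<open>Completing the square shows that the image term has the same shifted Gaussian as the
  first term of \<open>survival\<close>, multiplied by \<open>exp (- 2 * w * x / sqrt s)\<close>.
  For \<open>w \<ge> 0\<close> this factor lies on the side of 1 dictated by the sign of
  \<open>x\<close>, which gives the sign of \<open>survival\<close>.\<close>

lemma exp_psi_shift:
  assumes s: "0 < s"
  shows "ennreal (exp (- 2 * \<mu> * x) * psi s (\<mu> * s - x)) =
    (\<integral>\<^sup>+w. ennreal (std_normal_density (w - (x + \<mu> * s) / sqrt s) * exp (- 2 * w * x / sqrt s)) *
       indicator {0..} w \<partial>lborel)"
proof -
  have *: "exp (- 2 * \<mu> * x) * std_normal_density (w - (\<mu> * s - x) / sqrt s) =
    std_normal_density (w - (x + \<mu> * s) / sqrt s) * exp (- 2 * w * x / sqrt s)" for w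
  proof -
    define r where "r = sqrt s"
    have r: "r > 0" "s = r\<^sup>2" using s by (auto simp: r_def)
    have "- 2 * \<mu> * x - (w - (\<mu> * r\<^sup>2 - x) / r)\<^sup>2 / 2 = - (w - (x + \<mu> * r\<^sup>2) / r)\<^sup>2 / 2 - 2 * w * x / r"
      using r by (simp add: field_simps power2_eq_square)
    then show ?thesis
      unfolding std_normal_density_def r_def[symmetric] by (simp add: r(2)[symmetric] mult_exp_exp)
  qed
  have "ennreal (exp (- 2 * \<mu> * x) * psi s (\<mu> * s - x)) =
    (\<integral>\<^sup>+w. ennreal (exp (- 2 * \<mu> * x)) * (ennreal (std_normal_density (w - (\<mu> * s - x) / sqrt s)) * indicator {0..} w) \<partial>lborel)"
    by (simp add: ennreal_mult psi_nonneg ennreal_psi_shift[OF s] nn_integral_cmult)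
  also have "\<dots> = (\<integral>\<^sup>+w. ennreal (std_normal_density (w - (x + \<mu> * s) / sqrt s) * exp (- 2 * w * x / sqrt s)) *
       indicator {0..} w \<partial>lborel)"
    unfolding *[symmetric] by (intro nn_integral_cong) (simp add: mult.assoc ennreal_mult)
  finally show ?thesis .
qed

lemma survival_nonneg:
  assumes s: "0 \<le> s" and x: "0 \<le> x"
  shows "0 \<le> survival \<mu> s x"
proof (cases "s = 0")
  case True
  then show ?thesis using x by (auto simp: survival_def psi_def)
next
  case False
  with s have s: "0 < s" by simp
  have "ennreal (exp (- 2 * \<mu> * x) * psi s (\<mu> * s - x)) \<le> ennreal (psi s (x + \<mu> * s))"
    unfolding exp_psi_shift[OF s] ennreal_psi_shift[OF s]
  proof (intro nn_integral_mono)
    fix w :: real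
    show "ennreal (std_normal_density (w - (x + \<mu> * s) / sqrt s) * exp (- 2 * w * x / sqrt s)) * indicator {0..} w
      \<le> ennreal (std_normal_density (w - (x + \<mu> * s) / sqrt s)) * indicator {0..} w"
    proof (cases "0 \<le> w")
      case True
      have "- 2 * w * x / sqrt s \<le> 0"
        using True x s by (intro divide_nonpos_nonneg) auto
      then have "std_normal_density (w - (x + \<mu> * s) / sqrt s) * exp (- 2 * w * x / sqrt s) \<le>
          std_normal_density (w - (x + \<mu> * s) / sqrt s) * 1"
        by (intro mult_left_mono) auto
      then have "ennreal (std_normal_density (w - (x + \<mu> * s) / sqrt s) * exp (- 2 * w * x / sqrt s))
          \<le> ennreal (std_normal_density (w - (x + \<mu> * s) / sqrt s))"
        by (intro ennreal_leI) simp
      then show ?thesis by (rule mult_right_mono) simp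
    qed auto
  qed
  then show ?thesis by (simp add: survival_def psi_nonneg)
qed

lemma survival_nonpos:
  assumes s: "0 \<le> s" and x: "x \<le> 0"
  shows "survival \<mu> s x \<le> 0"
proof (cases "s = 0")
  case True
  then show ?thesis using x by (auto simp: survival_def psi_def)
next
  case False
  with s have s: "0 < s" by simp
  have "ennreal (psi s (x + \<mu> * s)) \<le> ennreal (exp (- 2 * \<mu> * x) * psi s (\<mu> * s - x))"
    unfolding exp_psi_shift[OF s] ennreal_psi_shift[OF s]
  proof (intro nn_integral_mono)
    fix w :: real
    show "ennreal (std_normal_density (w - (x + \<mu> * s) / sqrt s)) * indicator {0..} w
      \<le> ennreal (std_normal_density (w - (x + \<mu> * s) / sqrt s) * exp (- 2 * w * x / sqrt s)) * indicator {0..} w"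
    proof (cases "0 \<le> w")
      case True
      have "0 \<le> - 2 * w * x / sqrt s"
        using True x s by (intro divide_nonneg_nonneg) (auto simp: mult_nonneg_nonpos)
      then have "std_normal_density (w - (x + \<mu> * s) / sqrt s) * 1 \<le>
          std_normal_density (w - (x + \<mu> * s) / sqrt s) * exp (- 2 * w * x / sqrt s)"
        by (intro mult_left_mono) auto
      then have "ennreal (std_normal_density (w - (x + \<mu> * s) / sqrt s)) \<le>
          ennreal (std_normal_density (w - (x + \<mu> * s) / sqrt s) * exp (- 2 * w * x / sqrt s))"
        by (intro ennreal_leI) simp
      then show ?thesis by (rule mult_right_mono) simp
    qed auto
  qed
  then show ?thesis by (simp add: survival_def psi_nonneg)
qed

lemma survival_0: "0 < x \<Longrightarrow> survival \<mu> 0 x = 1"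
  by (auto simp: survival_def psi_def)

lemma continuous_on_survival:
  assumes "0 < s"
  shows "continuous_on S (survival \<mu> s)"
proof -
  have "survival \<mu> s = (\<lambda>x. Phi ((x + \<mu> * s) / sqrt s) - exp (- 2 * \<mu> * x) * Phi ((\<mu> * s - x) / sqrt s))"
    using assms by (simp add: survival_def psi_def fun_eq_iff)
  then show ?thesis
    using assms by (simp only:) (intro continuous_intros, simp_all)
qed

text \<open>Multiplying the centred density by \<open>exp (- 2 * \<mu> * d)\<close> moves its mean to \<open>- 2 * \<mu> * h\<close>,
  which reverses the sign of the drift.\<close>

lemma exp_psi_step:
  assumes s: "0 \<le> s" and h: "0 < h"
  shows "(\<integral>\<^sup>+d. ennreal (normal_density 0 (sqrt h) d) *
      ennreal (exp (- 2 * \<mu> * (x + \<mu> * h + d)) * psi s (\<mu> * s - (x + \<mu> * h + d))) \<partial>lborel) =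
    ennreal (exp (- 2 * \<mu> * x) * psi (s + h) (\<mu> * (s + h) - x))"
proof -
  let ?N = "\<lambda>d. normal_density 0 (sqrt h) d"
  \<comment> \<open>Replacing \<open>d\<close> by \<open>- 2 * \<mu> * h - d\<close> absorbs the
    shift of the mean and also reflects, so that \<open>d\<close> enters \<open>psi\<close> with a
    plus sign, as \<open>psi_step\<close> requires.\<close>
  have *: "?N (- 2 * \<mu> * h + (-1) * d) * (exp (- 2 * \<mu> * (x + \<mu> * h + (- 2 * \<mu> * h + (-1) * d))) *
      psi s (\<mu> * s - (x + \<mu> * h + (- 2 * \<mu> * h + (-1) * d))))
    = exp (- 2 * \<mu> * x) * (?N d * psi s (\<mu> * (s + h) - x + d))" for d
  proof -
    have "- (- 2 * \<mu> * h - d)\<^sup>2 / (2 * h) + - 2 * \<mu> * (x - \<mu> * h - d) = - 2 * \<mu> * x - d\<^sup>2 / (2 * h)"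
      using h by (simp add: field_simps power2_eq_square)
    then have "?N (- 2 * \<mu> * h - d) * exp (- 2 * \<mu> * (x - \<mu> * h - d)) = exp (- 2 * \<mu> * x) * ?N d"
      using h by (simp add: normal_density_def mult_exp_exp)
    moreover have "- 2 * \<mu> * h + (-1) * d = - 2 * \<mu> * h - d"
      "x + \<mu> * h + (- 2 * \<mu> * h - d) = x - \<mu> * h - d"
      "\<mu> * s - (x - \<mu> * h - d) = \<mu> * (s + h) - x + d"
      by (simp_all add: algebra_simps)
    ultimately show ?thesis by (simp only: mult.assoc[symmetric])
  qed
  have "(\<integral>\<^sup>+d. ennreal (?N d) *
      ennreal (exp (- 2 * \<mu> * (x + \<mu> * h + d)) * psi s (\<mu> * s - (x + \<mu> * h + d))) \<partial>lborel)
    = (\<integral>\<^sup>+d. ennreal (?N d * (exp (- 2 * \<mu> * (x + \<mu> * h + d)) *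
        psi s (\<mu> * s - (x + \<mu> * h + d)))) \<partial>lborel)"
    by (simp add: ennreal_mult psi_nonneg)
  also have "\<dots> = (\<integral>\<^sup>+d. ennreal (exp (- 2 * \<mu> * x) * (?N d * psi s (\<mu> * (s + h) - x + d))) \<partial>lborel)"
    by (subst nn_integral_real_affine[where c = "-1" and t = "- 2 * \<mu> * h"]) (measurable, simp only: *, simp)
  also have "\<dots> = (\<integral>\<^sup>+d. ennreal (exp (- 2 * \<mu> * x)) * (ennreal (?N d) * ennreal (psi s (\<mu> * (s + h) - x + d))) \<partial>lborel)"
    by (simp add: ennreal_mult psi_nonneg)
  also have "\<dots> = ennreal (exp (- 2 * \<mu> * x) * psi (s + h) (\<mu> * (s + h) - x))"
    by (simp add: nn_integral_cmult psi_step[OF s h] ennreal_mult psi_nonneg)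
  finally show ?thesis .
qed

section \<open>The first passage density\<close>

text \<open>For \<open>x > 0\<close> and \<open>s > 0\<close> this is the inverse Gaussian
  (Bachelier-Levy) density of the first time Brownian motion with drift \<mu> started at
  \<open>x\<close> hits 0; its total mass is below 1 when \<mu> > 0.\<close>

definition passage_density :: "real \<Rightarrow> real \<Rightarrow> real \<Rightarrow> real" where
  "passage_density \<mu> s x = x / (s * sqrt s) * std_normal_density ((x + \<mu> * s) / sqrt s)"

text \<open>The weight \<open>exp (- 2 * \<mu> * x)\<close> makes the two Gaussian values equal, so
  only the inner derivatives differ, and \<open>(\<mu> * s - x) - (\<mu> * s + x) = - 2 * x\<close>
  remains.\<close>

lemma DERIV_survival:
  assumes s: "0 < s"
  shows "((\<lambda>s. survival \<mu> s x) has_real_derivative - passage_density \<mu> s x) (at s)"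
proof -
  have eq: "exp (- 2 * \<mu> * x) * std_normal_density ((\<mu> * s - x) / sqrt s) =
      std_normal_density ((x + \<mu> * s) / sqrt s)"
  proof -
    have "- 2 * \<mu> * x + - ((\<mu> * s - x) / sqrt s)\<^sup>2 / 2 = - ((x + \<mu> * s) / sqrt s)\<^sup>2 / 2"
      using s by (simp add: power_divide field_simps power2_eq_square)
    then show ?thesis by (simp add: std_normal_density_def mult_exp_exp)
  qed
  have sq: "sqrt s * sqrt s = s" "sqrt s > 0" using s by auto
  have d1: "((\<lambda>s. (x + \<mu> * s) / sqrt s) has_real_derivative (\<mu> * s - x) / (2 * s * sqrt s)) (at s)"
    using s sq by (auto intro!: derivative_eq_intros simp: field_simps)
  have d2: "((\<lambda>s. (\<mu> * s - x) / sqrt s) has_real_derivative (\<mu> * s + x) / (2 * s * sqrt s)) (at s)"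
    using s sq by (auto intro!: derivative_eq_intros simp: field_simps)
  let ?n = "std_normal_density ((x + \<mu> * s) / sqrt s)"
  have "((\<lambda>s. Phi ((x + \<mu> * s) / sqrt s) - exp (- 2 * \<mu> * x) * Phi ((\<mu> * s - x) / sqrt s))
    has_real_derivative
      ?n * ((\<mu> * s - x) / (2 * s * sqrt s)) - exp (- 2 * \<mu> * x) *
        (std_normal_density ((\<mu> * s - x) / sqrt s) * ((\<mu> * s + x) / (2 * s * sqrt s)))) (at s)"
    by (intro DERIV_diff DERIV_cmult DERIV_chain2[OF DERIV_Phi] d1 d2)
  moreover have "?n * ((\<mu> * s - x) / (2 * s * sqrt s)) - exp (- 2 * \<mu> * x) *
        (std_normal_density ((\<mu> * s - x) / sqrt s) * ((\<mu> * s + x) / (2 * s * sqrt s)))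
      = - passage_density \<mu> s x"
    unfolding mult.assoc[symmetric, of "exp _"] eq passage_density_def
    using s sq(2) by (simp add: field_simps)
  ultimately have "((\<lambda>s. Phi ((x + \<mu> * s) / sqrt s) - exp (- 2 * \<mu> * x) * Phi ((\<mu> * s - x) / sqrt s))
    has_real_derivative - passage_density \<mu> s x) (at s)" by (simp only:)
  then show ?thesis
    by (rule has_field_derivative_transform_within_open[of _ _ _ "{0<..}"])
       (use s in \<open>auto simp: survival_def psi_def\<close>)
qed

lemma survival_at_0:
  assumes x: "0 < x"
  shows "((\<lambda>s. survival \<mu> s x) \<longlongrightarrow> 1) (at_right 0)"
proof -
  have "filterlim (\<lambda>s. (x + \<mu> * s) / sqrt s) at_top (at_right 0)"
    and "filterlim (\<lambda>s. (\<mu> * s - x) / sqrt s) at_bot (at_right 0)"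
    using x by real_asymp+
  then have "((\<lambda>s. Phi ((x + \<mu> * s) / sqrt s) - exp (- 2 * \<mu> * x) * Phi ((\<mu> * s - x) / sqrt s))
      \<longlongrightarrow> 1 - exp (- 2 * \<mu> * x) * 0) (at_right 0)"
    by (intro tendsto_diff tendsto_mult tendsto_const filterlim_compose[OF Phi_at_top]
        filterlim_compose[OF Phi_at_bot])
  moreover have "\<forall>\<^sub>F s in at_right 0. survival \<mu> s x =
      Phi ((x + \<mu> * s) / sqrt s) - exp (- 2 * \<mu> * x) * Phi ((\<mu> * s - x) / sqrt s)"
    using eventually_at_right_less[of 0]
    by eventually_elim (simp add: survival_def psi_def)
  ultimately show ?thesis by (simp add: tendsto_cong)
qed

lemma borel_measurable_passage_density[measurable]:
  "(\<lambda>(s, x). passage_density \<mu> s x) \<in> borel_measurable (borel \<Otimes>\<^sub>M borel)"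
  unfolding passage_density_def std_normal_density_def by measurable

lemma passage_density_nonneg: "0 \<le> s \<Longrightarrow> 0 \<le> x \<Longrightarrow> 0 \<le> passage_density \<mu> s x"
  by (simp add: passage_density_def)

lemma nn_integral_passage_density:
  assumes x: "0 < x" and T: "0 < T"
  shows "(\<integral>\<^sup>+s. ennreal (passage_density \<mu> s x) * indicator {0<..<T} s \<partial>lborel) = ennreal (1 - survival \<mu> T x)"
proof -
  have cont: "isCont (\<lambda>s. passage_density \<mu> s x) s" if "0 < s" for s
    unfolding passage_density_def std_normal_density_def using that
    by (intro continuous_intros) auto
  have D: "((\<lambda>s. - survival \<mu> s x) has_real_derivative passage_density \<mu> s x) (at s)" if "0 < s" for s
    using DERIV_minus[OF DERIV_survival[OF that]] by simp
  \<comment> \<open>The derivative is available only for \<open>s > 0\<close>, so the fundamental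
    theorem is used on the open interval with one-sided limits; the limit 1 at 0 is the certain
    survival from \<open>x > 0\<close>.\<close>
  have "(((\<lambda>s. - survival \<mu> s x) \<circ> real_of_ereal) \<longlongrightarrow> - 1) (at_right (ereal 0))"
    unfolding comp_def ereal_tendsto_simps2[unfolded comp_def]
    using tendsto_minus[OF survival_at_0[OF x]]
    by (simp add: at_right_ereal filterlim_filtermap)
  moreover have "(((\<lambda>s. - survival \<mu> s x) \<circ> real_of_ereal) \<longlongrightarrow> - survival \<mu> T x) (at_left (ereal T))"
    using DERIV_isCont[OF D[OF T]]
    by (simp add: at_left_ereal filterlim_filtermap isCont_def filterlim_at_split comp_def)
  ultimately have int: "set_integrable lborel (einterval (ereal 0) (ereal T)) (\<lambda>s. passage_density \<mu> s x)"
     "(LBINT s=ereal 0..ereal T. passage_density \<mu> s x) = - survival \<mu> T x - - 1"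
    using T x passage_density_nonneg
    by (intro interval_integral_FTC_nonneg[where F = "\<lambda>s. - survival \<mu> s x"] D cont AE_I2; simp)+
  have "(\<integral>\<^sup>+s. ennreal (passage_density \<mu> s x) * indicator {0<..<T} s \<partial>lborel) =
    (\<integral>\<^sup>+s. ennreal (indicator {0<..<T} s *\<^sub>R passage_density \<mu> s x) \<partial>lborel)"
    by (intro nn_integral_cong) (auto simp: indicator_def)
  also have "\<dots> = ennreal (LINT s:{0<..<T}|lborel. passage_density \<mu> s x)"
    unfolding set_lebesgue_integral_def
    using int(1) x by (intro nn_integral_eq_integral)
      (auto simp: set_integrable_def passage_density_nonneg indicator_def)
  also have "(LINT s:{0<..<T}|lborel. passage_density \<mu> s x) = 1 - survival \<mu> T x"
    using int(2) T by (simp add: interval_lebesgue_integral_def)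
  finally show ?thesis .
qed

text \<open>The normal density of \<open>X a\<close> times the passage density of \<open>x\<close> is a constant times
  \<open>x * exp (- x\<^sup>2 / (2 * v))\<close> with \<open>v = a * s / (a + s)\<close>; the terms linear in \<open>\<mu> * x\<close> cancel.\<close>

lemma nn_integral_normal_passage_density:
  assumes a: "0 < a" and s: "0 < s"
  shows "(\<integral>\<^sup>+x. ennreal (normal_density (\<mu> * a) (sqrt a) x * passage_density \<mu> s x) * indicator {0..} x \<partial>lborel) =
    ennreal (1 / (2 * pi) * (1 / (a + s) * sqrt (a / s) * exp (- (\<mu>\<^sup>2 / 2) * (a + s))))"
proof -
  define v where "v = a * s / (a + s)"
  define C where "C = exp (- (\<mu>\<^sup>2 / 2) * (a + s)) / (2 * pi * sqrt a * (s * sqrt s))"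
  have v: "0 < v" using a s by (simp add: v_def)
  have C: "0 < C" using a s by (simp add: C_def)
  have eq: "normal_density (\<mu> * a) (sqrt a) x * passage_density \<mu> s x = C * (x * exp (- x\<^sup>2 / (2 * v)))" for x
  proof -
    have "- (x - \<mu> * a)\<^sup>2 / (2 * a) + - ((x + \<mu> * s)\<^sup>2 / s) / 2 = - (\<mu>\<^sup>2 / 2) * (a + s) + - x\<^sup>2 / (2 * v)"
      using a s unfolding v_def by (simp add: field_simps power2_eq_square)
    then have "exp (- (x - \<mu> * a)\<^sup>2 / (2 * a)) * exp (- ((x + \<mu> * s)\<^sup>2 / s) / 2) =
        exp (- (\<mu>\<^sup>2 / 2) * (a + s)) * exp (- x\<^sup>2 / (2 * v))"
      by (simp only: mult_exp_exp)
    moreover have "sqrt (2 * pi * a) * sqrt (2 * pi) = sqrt (2 * pi) * sqrt (2 * pi) * sqrt a"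
      unfolding real_sqrt_mult[of "2 * pi" a] by (simp only: mult_ac)
    then have "sqrt (2 * pi * a) * sqrt (2 * pi) = 2 * pi * sqrt a"
      by simp
    ultimately show ?thesis
      unfolding normal_density_def passage_density_def C_def
      using a s by (simp add: power_divide field_simps)
  qed
  have "(\<integral>\<^sup>+x. ennreal (normal_density (\<mu> * a) (sqrt a) x * passage_density \<mu> s x) * indicator {0..} x \<partial>lborel)
     = (\<integral>\<^sup>+x. ennreal (C * (x * exp (- x\<^sup>2 / (2 * v)))) * indicator {0..} x \<partial>lborel)"
    unfolding eq ..
  also have "\<dots> = ennreal (0 - (- C * v * exp (- 0\<^sup>2 / (2 * v))))"
  proof (rule nn_integral_FTC_atLeast)
    show "((\<lambda>x. - C * v * exp (- x\<^sup>2 / (2 * v))) has_real_derivative C * (x * exp (- x\<^sup>2 / (2 * v)))) (at x)" for x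
      using v by (auto intro!: derivative_eq_intros simp: field_simps)
    show "((\<lambda>x. - C * v * exp (- x\<^sup>2 / (2 * v))) \<longlongrightarrow> 0) at_top"
      using v C by real_asymp
  qed (use C in auto)
  also have "0 - (- C * v * exp (- 0\<^sup>2 / (2 * v))) = 1 / (2 * pi) * (1 / (a + s) * sqrt (a / s) * exp (- (\<mu>\<^sup>2 / 2) * (a + s)))"
  proof -
    \<comment> \<open>Naming the square roots makes \<open>a\<close> and \<open>s\<close> products
      of them, and the remaining identity is rational in \<open>r\<close> and
      \<open>q\<close>.\<close>
    define r q E where "r = sqrt a" and "q = sqrt s" and "E = exp (- (\<mu>\<^sup>2 / 2) * (a + s))"
    have rq: "0 < r" "0 < q" "a = r * r" "s = q * q"
      using a s by (auto simp: r_def q_def)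
    have "0 - (- C * v * exp (- 0\<^sup>2 / (2 * v))) = E / (2 * pi * r * (q * q * q)) * (r * r * (q * q) / (r * r + q * q))"
      unfolding C_def v_def r_def[symmetric] q_def[symmetric] E_def[symmetric] rq(3)[symmetric] rq(4)[symmetric]
      by simp
    also have "\<dots> = 1 / (2 * pi) * (1 / (r * r + q * q) * (r / q) * E)"
      using rq(1,2) by (simp add: divide_simps)
    finally show ?thesis
      unfolding real_sqrt_divide r_def[symmetric] q_def[symmetric] E_def[symmetric] rq(3)[symmetric] rq(4)[symmetric] .
  qed
  finally show ?thesis .
qed

text \<open>By Tonelli, averaging the passage density over the law of \<open>X a\<close> before
  integrating in time gives \<open>?J\<close>, the mass of paths positive at time \<open>a\<close>
  that hit zero within time \<open>T\<close>. Together with the surviving mass it makes up the mass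
  of the positive half-line.\<close>

lemma nn_integral_normal_survival:
  assumes a: "0 < a" and T: "0 < T"
  shows "(\<integral>\<^sup>+x. ennreal (normal_density (\<mu> * a) (sqrt a) x) * (ennreal (survival \<mu> T x) * indicator {0<..} x) \<partial>lborel) +
      (\<integral>\<^sup>+s. ennreal (1 / (2 * pi) * (1 / (a + s) * sqrt (a / s) * exp (- (\<mu>\<^sup>2 / 2) * (a + s)))) *
          indicator {0<..<T} s \<partial>lborel) =
    (\<integral>\<^sup>+x. ennreal (normal_density (\<mu> * a) (sqrt a) x) * indicator {0<..} x \<partial>lborel)"
    (is "?S + ?J = ?P")
proof -
  let ?N = "normal_density (\<mu> * a) (sqrt a)"
  have "?J = (\<integral>\<^sup>+s. (\<integral>\<^sup>+x. ennreal (?N x * passage_density \<mu> s x) * indicator {0..} x \<partial>lborel) * indicator {0<..<T} s \<partial>lborel)"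
  proof (intro nn_integral_cong)
    fix s :: real
    show "ennreal (1 / (2 * pi) * (1 / (a + s) * sqrt (a / s) * exp (- (\<mu>\<^sup>2 / 2) * (a + s)))) * indicator {0<..<T} s =
        (\<integral>\<^sup>+x. ennreal (?N x * passage_density \<mu> s x) * indicator {0..} x \<partial>lborel) * indicator {0<..<T} s"
    proof (cases "s \<in> {0<..<T}")
      case True
      then show ?thesis by (simp only: nn_integral_normal_passage_density[OF a] greaterThanLessThan_iff)
    qed simp
  qed
  also have "\<dots> = (\<integral>\<^sup>+s. (\<integral>\<^sup>+x. ennreal (?N x) * (ennreal (passage_density \<mu> s x) * indicator {0<..<T} s) * indicator {0<..} x \<partial>lborel) \<partial>lborel)"
  proof (intro nn_integral_cong)
    fix s :: real
    have "(\<integral>\<^sup>+x. ennreal (?N x * passage_density \<mu> s x) * indicator {0..} x \<partial>lborel) * indicator {0<..<T} s =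
      (\<integral>\<^sup>+x. ennreal (?N x * passage_density \<mu> s x) * indicator {0..} x * indicator {0<..<T} s \<partial>lborel)"
      by (subst nn_integral_multc) auto
    also have "\<dots> = (\<integral>\<^sup>+x. ennreal (?N x) * (ennreal (passage_density \<mu> s x) * indicator {0<..<T} s) * indicator {0<..} x \<partial>lborel)"
    proof (rule nn_integral_cong_AE, rule AE_mp[OF AE_lborel_singleton[of 0]], rule AE_I2, rule impI)
      fix x :: real
      assume "x \<noteq> 0"
      then consider "0 < x" "0 < s" "s < T" | "s \<notin> {0<..<T}" | "x < 0" by force
      then show "ennreal (?N x * passage_density \<mu> s x) * indicator {0..} x * indicator {0<..<T} s =
          ennreal (?N x) * (ennreal (passage_density \<mu> s x) * indicator {0<..<T} s) * indicator {0<..} x"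
        by cases (simp_all add: ennreal_mult passage_density_nonneg)
    qed
    finally show "(\<integral>\<^sup>+x. ennreal (?N x * passage_density \<mu> s x) * indicator {0..} x \<partial>lborel) * indicator {0<..<T} s = \<dots>" .
  qed
  also have "\<dots> = (\<integral>\<^sup>+x. (\<integral>\<^sup>+s. ennreal (?N x) * (ennreal (passage_density \<mu> s x) * indicator {0<..<T} s) * indicator {0<..} x \<partial>lborel) \<partial>lborel)"
    by (rule lborel_pair.Fubini') measurable
  also have "\<dots> = (\<integral>\<^sup>+x. ennreal (?N x) * ennreal (1 - survival \<mu> T x) * indicator {0<..} x \<partial>lborel)"
  proof (intro nn_integral_cong)
    fix x :: real
    have "(\<integral>\<^sup>+s. ennreal (?N x) * (ennreal (passage_density \<mu> s x) * indicator {0<..<T} s) * indicator {0<..} x \<partial>lborel)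
      = ennreal (?N x) * (\<integral>\<^sup>+s. ennreal (passage_density \<mu> s x) * indicator {0<..<T} s \<partial>lborel) * indicator {0<..} x"
      by (subst nn_integral_multc, measurable)  (subst nn_integral_cmult, auto)
    also have "\<dots> = ennreal (?N x) * ennreal (1 - survival \<mu> T x) * indicator {0<..} x"
      using nn_integral_passage_density[OF _ T] by (auto simp: indicator_def)
    finally show "(\<integral>\<^sup>+s. ennreal (?N x) * (ennreal (passage_density \<mu> s x) * indicator {0<..<T} s) * indicator {0<..} x \<partial>lborel) = \<dots>" .
  qed
  finally have J: "?J = (\<integral>\<^sup>+x. ennreal (?N x) * ennreal (1 - survival \<mu> T x) * indicator {0<..} x \<partial>lborel)" .
  have "ennreal (survival \<mu> T x) + ennreal (1 - survival \<mu> T x) = 1" if "0 < x" for x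
    using survival_nonneg[of T x \<mu>] survival_le_1[of \<mu> T x] T that
    by (simp add: ennreal_plus[symmetric] del: ennreal_plus)
  then have "ennreal (?N x) * (ennreal (survival \<mu> T x) * indicator {0<..} x) +
     ennreal (?N x) * ennreal (1 - survival \<mu> T x) * indicator {0<..} x = ennreal (?N x) * indicator {0<..} x" for x
    by (auto simp: indicator_def distrib_left[symmetric])
  then show ?thesis
    unfolding J by (subst nn_integral_add[symmetric]) auto
qed

section \<open>The Markov property on a finite grid\<close>

lemma normal_density_mgf:
  assumes h: "0 < h"
  shows "(\<integral>\<^sup>+d. ennreal (normal_density 0 (sqrt h) d) * ennreal (exp (l * d)) \<partial>lborel) = ennreal (exp (l\<^sup>2 * h / 2))"
proof -
  have eq: "normal_density 0 (sqrt h) d * exp (l * d) = exp (l\<^sup>2 * h / 2) * normal_density (l * h) (sqrt h) d" for d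
  proof -
    have "- (d - 0)\<^sup>2 / (2 * h) + l * d = l\<^sup>2 * h / 2 + - (d - l * h)\<^sup>2 / (2 * h)"
      using h by (simp add: field_simps power2_eq_square)
    then have "exp (- (d - 0)\<^sup>2 / (2 * h)) * exp (l * d) = exp (l\<^sup>2 * h / 2) * exp (- (d - l * h)\<^sup>2 / (2 * h))"
      by (simp only: mult_exp_exp)
    then show ?thesis using h by (simp add: normal_density_def)
  qed
  have "(\<integral>\<^sup>+d. ennreal (normal_density 0 (sqrt h) d) * ennreal (exp (l * d)) \<partial>lborel) =
    (\<integral>\<^sup>+d. ennreal (exp (l\<^sup>2 * h / 2)) * ennreal (normal_density (l * h) (sqrt h) d) \<partial>lborel)"
    by (intro nn_integral_cong) (simp add: ennreal_mult[symmetric] eq)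
  also have "\<dots> = ennreal (exp (l\<^sup>2 * h / 2)) * ennreal 1"
    using h by (simp add: nn_integral_cmult nn_integral_eq_integral)
  finally show ?thesis by simp
qed

context standard_brownian_motion
begin

lemma measurable_with_drift[measurable]: "0 \<le> s \<Longrightarrow> with_drift \<mu> B s \<in> borel_measurable M"
  using rv[of s] unfolding with_drift_def[abs_def] by measurable

lemma nn_integral_increment:
  assumes "0 \<le> s" "s < u" and f: "f \<in> borel_measurable borel"
  shows "(\<integral>\<^sup>+\<omega>. f (B u \<omega> - B s \<omega>) \<partial>M) = (\<integral>\<^sup>+d. ennreal (normal_density 0 (sqrt (u - s)) d) * f d \<partial>lborel)"
  using distributed_nn_integral[OF normal_increments[OF assms(1,2)]] f by simp

lemma nn_integral_exp_increment:
  assumes "0 \<le> s" "s < u"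
  shows "(\<integral>\<^sup>+\<omega>. ennreal (exp (l * (with_drift \<mu> B u \<omega> - with_drift \<mu> B s \<omega>))) \<partial>M) =
    ennreal (exp (l * \<mu> * (u - s) + l\<^sup>2 * (u - s) / 2))"
proof -
  have "(\<integral>\<^sup>+\<omega>. ennreal (exp (l * (with_drift \<mu> B u \<omega> - with_drift \<mu> B s \<omega>))) \<partial>M) =
    (\<integral>\<^sup>+\<omega>. ennreal (exp (l * \<mu> * (u - s))) * ennreal (exp (l * (B u \<omega> - B s \<omega>))) \<partial>M)"
    by (intro nn_integral_cong)
       (simp add: ennreal_mult[symmetric] mult_exp_exp with_drift_def algebra_simps)
  also have "\<dots> = (\<integral>\<^sup>+d. ennreal (normal_density 0 (sqrt (u - s)) d) *
      (ennreal (exp (l * \<mu> * (u - s))) * ennreal (exp (l * d))) \<partial>lborel)"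
    using nn_integral_increment[OF assms, of "\<lambda>d. ennreal (exp (l * \<mu> * (u - s))) * ennreal (exp (l * d))"] by simp
  also have "\<dots> = ennreal (exp (l * \<mu> * (u - s))) *
      (\<integral>\<^sup>+d. ennreal (normal_density 0 (sqrt (u - s)) d) * ennreal (exp (l * d)) \<partial>lborel)"
    by (subst nn_integral_cmult[symmetric]) (auto simp: mult_ac)
  also have "\<dots> = ennreal (exp (l * \<mu> * (u - s) + l\<^sup>2 * (u - s) / 2))"
    using assms by (subst normal_density_mgf) (simp_all add: ennreal_mult[symmetric] mult_exp_exp)
  finally show ?thesis .
qed

lemma integrable_exp_increment:
  assumes "0 \<le> s" "s < u"
  shows "integrable M (\<lambda>\<omega>. exp (l * (with_drift \<mu> B u \<omega> - with_drift \<mu> B s \<omega>)))"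
    and "expectation (\<lambda>\<omega>. exp (l * (with_drift \<mu> B u \<omega> - with_drift \<mu> B s \<omega>))) =
      exp (l * \<mu> * (u - s) + l\<^sup>2 * (u - s) / 2)"
proof -
  have m: "(\<lambda>\<omega>. exp (l * (with_drift \<mu> B u \<omega> - with_drift \<mu> B s \<omega>))) \<in> borel_measurable M"
    using measurable_with_drift[of s \<mu>] measurable_with_drift[of u \<mu>] assms by simp
  show "integrable M (\<lambda>\<omega>. exp (l * (with_drift \<mu> B u \<omega> - with_drift \<mu> B s \<omega>)))"
    by (intro integrableI_bounded m) (simp add: nn_integral_exp_increment[OF assms])
  show "expectation (\<lambda>\<omega>. exp (l * (with_drift \<mu> B u \<omega> - with_drift \<mu> B s \<omega>))) =
      exp (l * \<mu> * (u - s) + l\<^sup>2 * (u - s) / 2)"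
    using m by (subst integral_eq_nn_integral) (auto simp: nn_integral_exp_increment[OF assms])
qed

lemma with_drift_0: "\<omega> \<in> space M \<Longrightarrow> with_drift \<mu> B 0 \<omega> = 0"
  by (simp add: with_drift_def start)

lemma integrable_exp_with_drift:
  assumes "0 < s"
  shows "integrable M (\<lambda>\<omega>. exp (l * with_drift \<mu> B s \<omega>))"
proof -
  have "integrable M (\<lambda>\<omega>. exp (l * (with_drift \<mu> B s \<omega> - with_drift \<mu> B 0 \<omega>)))"
    using assms by (intro integrable_exp_increment) auto
  then show ?thesis
    by (rule Bochner_Integration.integrable_cong[THEN iffD1, rotated -1]) (auto simp: with_drift_0)
qed

text \<open>The path at the times up to \<open>\<tau> n\<close> is a function of the first
  \<open>n\<close> increments, and the last increment is independent of them; so the joint law is a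
  product and Fubini integrates the last increment out. Unequal steps are allowed because the step
  from 0 to \<open>a\<close> differs from the mesh, and \<open>I\<close> selects the times at which
  the level is imposed.\<close>

lemma nn_integral_markov:
  fixes \<tau> :: "nat \<Rightarrow> real" and f :: "real \<Rightarrow> ennreal"
  assumes mono: "mono_on {..Suc n} \<tau>" and \<tau>0: "\<tau> 0 = 0" and less: "\<tau> n < \<tau> (Suc n)"
    and I: "I \<subseteq> {..n}" and f[measurable]: "f \<in> borel_measurable borel"
  shows "(\<integral>\<^sup>+\<omega>. indicator {\<omega>. \<forall>i\<in>I. y < with_drift \<mu> B (\<tau> i) \<omega>} \<omega> * f (with_drift \<mu> B (\<tau> (Suc n)) \<omega>) \<partial>M) =
    (\<integral>\<^sup>+\<omega>. indicator {\<omega>. \<forall>i\<in>I. y < with_drift \<mu> B (\<tau> i) \<omega>} \<omega> *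
       (\<integral>\<^sup>+d. ennreal (normal_density 0 (sqrt (\<tau> (Suc n) - \<tau> n)) d) *
          f (with_drift \<mu> B (\<tau> n) \<omega> + \<mu> * (\<tau> (Suc n) - \<tau> n) + d) \<partial>lborel) \<partial>M)"
proof -
  define D where "D i \<omega> = B (\<tau> (Suc i)) \<omega> - B (\<tau> i) \<omega>" for i \<omega>
  define V where "V \<omega> = (\<lambda>i\<in>{..<n}. D i \<omega>)" for \<omega>
  \<comment> \<open>\<open>S i\<close> rebuilds the value of the drifted path at
    \<open>\<tau> i\<close> from the increments; the starting value 0 makes the sum
    telescope.\<close>
  define S where "S i v = (\<Sum>j<i. v j) + \<mu> * \<tau> i" for i and v :: "nat \<Rightarrow> real"
  define F where "F = (\<lambda>(v, w :: nat \<Rightarrow> real). indicator {v. \<forall>i\<in>I. y < S i v} v *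
      f (S n v + \<mu> * (\<tau> (Suc n) - \<tau> n) + w n))"
  define W where "W \<omega> = (\<lambda>i\<in>{n}. D i \<omega>)" for \<omega>
  let ?P = "PiM {..<n} (\<lambda>_. borel :: real measure)"
  let ?Q = "PiM {n} (\<lambda>_. borel :: real measure)"
  have ind: "indep_vars (\<lambda>_. borel) D {..<Suc n}"
    using indep_increments[of \<tau> "Suc n"] mono \<tau>0 by (simp add: D_def[abs_def])
  have indep: "indep_var ?P V ?Q W"
    unfolding V_def[abs_def] W_def[abs_def] by (rule indep_var_restrict[OF ind]) auto
  have V[measurable]: "V \<in> measurable M ?P" and W[measurable]: "W \<in> measurable M ?Q"
    using indep by (auto dest: indep_var_rv1 indep_var_rv2)
  have distr: "distr M (?P \<Otimes>\<^sub>M ?Q) (\<lambda>\<omega>. (V \<omega>, W \<omega>)) = distr M ?P V \<Otimes>\<^sub>M distr M ?Q W"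
    using indep unfolding indep_var_distribution_eq by auto
  have S[measurable]: "S i \<in> borel_measurable ?P" if "i \<le> n" for i
    using that unfolding S_def[abs_def] by (intro borel_measurable_add borel_measurable_sum) auto
  have "countable I" using I by (rule countable_subset) auto
  then have [measurable]: "Measurable.pred ?P (\<lambda>v. \<forall>i\<in>I. y < S i v)"
    using I by (intro measurable_pred_countable) (auto intro!: measurable_compose[OF S])
  have F[measurable]: "F \<in> borel_measurable (?P \<Otimes>\<^sub>M ?Q)"
    using S[OF order_refl] unfolding F_def by measurable
  interpret V: prob_space "distr M ?P V" by (rule prob_space_distr) fact
  interpret W: prob_space "distr M ?Q W" by (rule prob_space_distr) fact
  have XS: "with_drift \<mu> B (\<tau> i) \<omega> = S i (V \<omega>)" if "i \<le> n" "\<omega> \<in> space M" for i \<omega>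
  proof -
    have "(\<Sum>j<i. V \<omega> j) = (\<Sum>j<i. B (\<tau> (Suc j)) \<omega> - B (\<tau> j) \<omega>)"
      using that by (intro sum.cong) (auto simp: V_def D_def)
    also have "\<dots> = B (\<tau> i) \<omega>" using that sum_lessThan_telescope[of "\<lambda>j. B (\<tau> j) \<omega>" i] by (simp add: \<tau>0 start)
    finally show ?thesis by (simp add: with_drift_def S_def)
  qed
  have ind_eq: "indicator {\<omega>. \<forall>i\<in>I. y < with_drift \<mu> B (\<tau> i) \<omega>} \<omega> = (indicator {v. \<forall>i\<in>I. y < S i v} (V \<omega>) :: ennreal)"
    if "\<omega> \<in> space M" for \<omega>
    using XS[OF _ that] I by (auto simp: indicator_def subset_iff)
  have XSuc: "with_drift \<mu> B (\<tau> (Suc n)) \<omega> = S n (V \<omega>) + \<mu> * (\<tau> (Suc n) - \<tau> n) + D n \<omega>" if "\<omega> \<in> space M" for \<omega>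
    using XS[OF order_refl that] by (simp add: with_drift_def D_def algebra_simps)
  have "(\<integral>\<^sup>+\<omega>. indicator {\<omega>. \<forall>i\<in>I. y < with_drift \<mu> B (\<tau> i) \<omega>} \<omega> * f (with_drift \<mu> B (\<tau> (Suc n)) \<omega>) \<partial>M) =
    (\<integral>\<^sup>+\<omega>. F (V \<omega>, W \<omega>) \<partial>M)"
    by (intro nn_integral_cong) (simp add: F_def ind_eq XSuc W_def)
  also have "\<dots> = (\<integral>\<^sup>+p. F p \<partial>(distr M ?P V \<Otimes>\<^sub>M distr M ?Q W))"
    by (simp add: distr[symmetric] nn_integral_distr)
  also have "\<dots> = (\<integral>\<^sup>+v. \<integral>\<^sup>+d. F (v, d) \<partial>distr M ?Q W \<partial>distr M ?P V)"
    by (subst W.nn_integral_fst[symmetric]) auto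
  also have "\<dots> = (\<integral>\<^sup>+\<omega>. \<integral>\<^sup>+d. F (V \<omega>, d) \<partial>distr M ?Q W \<partial>M)"
    by (subst nn_integral_distr) (auto intro!: W.borel_measurable_nn_integral)
  also have "\<dots> = (\<integral>\<^sup>+\<omega>. indicator {v. \<forall>i\<in>I. y < S i v} (V \<omega>) *
     (\<integral>\<^sup>+d. ennreal (normal_density 0 (sqrt (\<tau> (Suc n) - \<tau> n)) d) * f (S n (V \<omega>) + \<mu> * (\<tau> (Suc n) - \<tau> n) + d) \<partial>lborel) \<partial>M)"
  proof (intro nn_integral_cong)
    fix \<omega>
    let ?g = "\<lambda>d. f (S n (V \<omega>) + \<mu> * (\<tau> (Suc n) - \<tau> n) + d)"
    have "0 \<le> \<tau> n" using mono_onD[OF mono, of 0 n] \<tau>0 by simp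
    then have "(\<integral>\<^sup>+w. ?g (w n) \<partial>distr M ?Q W) =
        (\<integral>\<^sup>+d. ennreal (normal_density 0 (sqrt (\<tau> (Suc n) - \<tau> n)) d) * ?g d \<partial>lborel)"
      using nn_integral_increment[OF _ less, of ?g] by (simp add: nn_integral_distr D_def W_def)
    then show "(\<integral>\<^sup>+d. F (V \<omega>, d) \<partial>distr M ?Q W) = indicator {v. \<forall>i\<in>I. y < S i v} (V \<omega>) *
     (\<integral>\<^sup>+d. ennreal (normal_density 0 (sqrt (\<tau> (Suc n) - \<tau> n)) d) * ?g d \<partial>lborel)"
      unfolding F_def by (simp add: nn_integral_cmult)
  qed
  also have "\<dots> = (\<integral>\<^sup>+\<omega>. indicator {\<omega>. \<forall>i\<in>I. y < with_drift \<mu> B (\<tau> i) \<omega>} \<omega> *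
       (\<integral>\<^sup>+d. ennreal (normal_density 0 (sqrt (\<tau> (Suc n) - \<tau> n)) d) *
          f (with_drift \<mu> B (\<tau> n) \<omega> + \<mu> * (\<tau> (Suc n) - \<tau> n) + d) \<partial>lborel) \<partial>M)"
    by (intro nn_integral_cong) (simp add: ind_eq XS)
  finally show ?thesis .
qed

definition grid_above :: "real \<Rightarrow> real \<Rightarrow> real \<Rightarrow> real \<Rightarrow> nat \<Rightarrow> 'a set" where
  "grid_above \<mu> y a h k = {\<omega> \<in> space M. \<forall>j\<le>k. y < with_drift \<mu> B (a + real j * h) \<omega>}"

lemma grid_above_sets[measurable]: "0 \<le> a \<Longrightarrow> 0 \<le> h \<Longrightarrow> grid_above \<mu> y a h k \<in> sets M"
  unfolding grid_above_def
  by (intro sets.sets_Collect_countable_All sets.sets_Collect_imp) measurable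

lemma nn_integral_grid_above_step:
  fixes f :: "real \<Rightarrow> ennreal"
  assumes a: "0 < a" and h: "0 < h" and f: "f \<in> borel_measurable borel"
  shows "(\<integral>\<^sup>+\<omega>. f (with_drift \<mu> B (a + real (Suc k) * h) \<omega>) * indicator (grid_above \<mu> y a h k) \<omega> \<partial>M) =
    (\<integral>\<^sup>+\<omega>. (\<integral>\<^sup>+d. ennreal (normal_density 0 (sqrt h) d) *
        f (with_drift \<mu> B (a + real k * h) \<omega> + \<mu> * h + d) \<partial>lborel) * indicator (grid_above \<mu> y a h k) \<omega> \<partial>M)"
proof -
  \<comment> \<open>Time 0 is put in front of the grid, which shifts the indices by one. The level
    is imposed only for indices \<open>1..Suc k\<close>, since the path starts at 0 and need not
    exceed \<open>y\<close> there.\<close>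
  define \<tau> where "\<tau> i = (if i = 0 then 0 else a + real (i - 1) * h)" for i
  have \<tau>: "\<tau> 0 = 0" "\<tau> (Suc j) = a + real j * h" for j
    by (auto simp: \<tau>_def)
  have mono: "mono_on {..Suc (Suc k)} \<tau>"
    using a h by (auto simp: mono_on_def \<tau>_def intro!: mult_right_mono)
  have ind: "indicator {\<omega>. \<forall>i\<in>{1..Suc k}. y < with_drift \<mu> B (\<tau> i) \<omega>} \<omega> = (indicator (grid_above \<mu> y a h k) \<omega> :: ennreal)"
    if "\<omega> \<in> space M" for \<omega>
  proof -
    have "{1..Suc k} = Suc ` {..k}" by (simp add: image_Suc_atMost)
    then have "(\<forall>i\<in>{1..Suc k}. y < with_drift \<mu> B (\<tau> i) \<omega>) \<longleftrightarrow> (\<forall>j\<le>k. y < with_drift \<mu> B (\<tau> (Suc j)) \<omega>)"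
      by (simp only: ball_simps) auto
    then show ?thesis using that by (simp add: grid_above_def \<tau> indicator_def)
  qed
  have diff: "\<tau> (Suc (Suc k)) - \<tau> (Suc k) = h"
    unfolding \<tau> by (simp add: algebra_simps)
  have "(\<integral>\<^sup>+\<omega>. f (with_drift \<mu> B (a + real (Suc k) * h) \<omega>) * indicator (grid_above \<mu> y a h k) \<omega> \<partial>M) =
    (\<integral>\<^sup>+\<omega>. indicator {\<omega>. \<forall>i\<in>{1..Suc k}. y < with_drift \<mu> B (\<tau> i) \<omega>} \<omega> *
       f (with_drift \<mu> B (\<tau> (Suc (Suc k))) \<omega>) \<partial>M)"
    by (intro nn_integral_cong) (simp only: ind \<tau> mult.commute)
  also have "\<dots> = (\<integral>\<^sup>+\<omega>. indicator {\<omega>. \<forall>i\<in>{1..Suc k}. y < with_drift \<mu> B (\<tau> i) \<omega>} \<omega> *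
       (\<integral>\<^sup>+d. ennreal (normal_density 0 (sqrt (\<tau> (Suc (Suc k)) - \<tau> (Suc k))) d) *
          f (with_drift \<mu> B (\<tau> (Suc k)) \<omega> + \<mu> * (\<tau> (Suc (Suc k)) - \<tau> (Suc k)) + d) \<partial>lborel) \<partial>M)"
    using h diff by (intro nn_integral_markov mono \<tau>(1) f) auto
  also have "\<dots> = (\<integral>\<^sup>+\<omega>. (\<integral>\<^sup>+d. ennreal (normal_density 0 (sqrt h) d) *
        f (with_drift \<mu> B (a + real k * h) \<omega> + \<mu> * h + d) \<partial>lborel) * indicator (grid_above \<mu> y a h k) \<omega> \<partial>M)"
    unfolding diff by (intro nn_integral_cong) (simp only: ind \<tau> mult.commute)
  finally show ?thesis .
qed

section \<open>Stopped survival functions along the grid\<close>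

lemma integrable_exp_psi:
  assumes "0 < u"
  shows "integrable M (\<lambda>\<omega>. exp (- 2 * \<mu> * (with_drift \<mu> B u \<omega> + c)) * psi s (\<mu> * s - (with_drift \<mu> B u \<omega> + c)))"
proof (rule Bochner_Integration.integrable_bound)
  have [measurable]: "with_drift \<mu> B u \<in> borel_measurable M" using assms by simp
  show "integrable M (\<lambda>\<omega>. exp (- 2 * \<mu> * c) * exp (- 2 * \<mu> * with_drift \<mu> B u \<omega>))"
    using integrable_exp_with_drift[OF assms, of "- 2 * \<mu>" \<mu>] by simp
  show "(\<lambda>\<omega>. exp (- 2 * \<mu> * (with_drift \<mu> B u \<omega> + c)) * psi s (\<mu> * s - (with_drift \<mu> B u \<omega> + c))) \<in> borel_measurable M"
    by measurable
  show "AE \<omega> in M. norm (exp (- 2 * \<mu> * (with_drift \<mu> B u \<omega> + c)) * psi s (\<mu> * s - (with_drift \<mu> B u \<omega> + c)))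
      \<le> norm (exp (- 2 * \<mu> * c) * exp (- 2 * \<mu> * with_drift \<mu> B u \<omega>))"
  proof (rule AE_I2)
    fix \<omega>
    have "exp (- 2 * \<mu> * (with_drift \<mu> B u \<omega> + c)) * psi s (\<mu> * s - (with_drift \<mu> B u \<omega> + c))
        \<le> exp (- 2 * \<mu> * (with_drift \<mu> B u \<omega> + c)) * 1"
      by (intro mult_left_mono psi_le_1) auto
    also have "\<dots> = exp (- 2 * \<mu> * c) * exp (- 2 * \<mu> * with_drift \<mu> B u \<omega>)"
      by (simp add: mult_exp_exp algebra_simps)
    finally show "norm (exp (- 2 * \<mu> * (with_drift \<mu> B u \<omega> + c)) * psi s (\<mu> * s - (with_drift \<mu> B u \<omega> + c)))
      \<le> norm (exp (- 2 * \<mu> * c) * exp (- 2 * \<mu> * with_drift \<mu> B u \<omega>))"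
      by (simp add: abs_mult psi_nonneg)
  qed
qed

lemma integrable_psi:
  assumes "0 < u"
  shows "integrable M (\<lambda>\<omega>. psi s (with_drift \<mu> B u \<omega> + c + \<mu> * s))"
proof -
  have [measurable]: "with_drift \<mu> B u \<in> borel_measurable M" using assms by simp
  show ?thesis
    by (rule integrable_const_bound[where B = 1]) (auto simp: psi_nonneg psi_le_1)
qed

lemma integrable_survival:
  assumes "0 < u"
  shows "integrable M (\<lambda>\<omega>. survival \<mu> s (with_drift \<mu> B u \<omega> + c))"
  unfolding survival_def
  by (intro Bochner_Integration.integrable_diff integrable_psi integrable_exp_psi assms)

text \<open>Splits the signed expectation into two nonnegative integrals, because the one-step
  Markov identity is stated for \<open>ennreal\<close>-valued functions.\<close>

lemma expectation_survival_indicator: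
  assumes u: "0 < u" and A: "A \<in> sets M"
  shows "expectation (\<lambda>\<omega>. survival \<mu> s (with_drift \<mu> B u \<omega> + c) * indicator A \<omega>) =
    enn2real (\<integral>\<^sup>+\<omega>. ennreal (psi s (with_drift \<mu> B u \<omega> + c + \<mu> * s)) * indicator A \<omega> \<partial>M) -
    enn2real (\<integral>\<^sup>+\<omega>. ennreal (exp (- 2 * \<mu> * (with_drift \<mu> B u \<omega> + c)) *
        psi s (\<mu> * s - (with_drift \<mu> B u \<omega> + c))) * indicator A \<omega> \<partial>M)"
proof -
  have [measurable]: "with_drift \<mu> B u \<in> borel_measurable M" using u by simp
  have 1: "expectation (\<lambda>\<omega>. f \<omega> * indicator A \<omega>) = enn2real (\<integral>\<^sup>+\<omega>. ennreal (f \<omega>) * indicator A \<omega> \<partial>M)"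
    if f[measurable]: "f \<in> borel_measurable M" and nonneg: "\<And>\<omega>. 0 \<le> f \<omega>" for f
  proof -
    have "expectation (\<lambda>\<omega>. f \<omega> * indicator A \<omega>) = enn2real (\<integral>\<^sup>+\<omega>. ennreal (f \<omega> * indicator A \<omega>) \<partial>M)"
      using A nonneg by (intro integral_eq_nn_integral) auto
    also have "(\<integral>\<^sup>+\<omega>. ennreal (f \<omega> * indicator A \<omega>) \<partial>M) = (\<integral>\<^sup>+\<omega>. ennreal (f \<omega>) * indicator A \<omega> \<partial>M)"
      by (intro nn_integral_cong) (simp add: indicator_def)
    finally show ?thesis .
  qed
  have "expectation (\<lambda>\<omega>. survival \<mu> s (with_drift \<mu> B u \<omega> + c) * indicator A \<omega>) =
    expectation (\<lambda>\<omega>. psi s (with_drift \<mu> B u \<omega> + c + \<mu> * s) * indicator A \<omega>) -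
    expectation (\<lambda>\<omega>. exp (- 2 * \<mu> * (with_drift \<mu> B u \<omega> + c)) *
        psi s (\<mu> * s - (with_drift \<mu> B u \<omega> + c)) * indicator A \<omega>)"
    unfolding survival_def left_diff_distrib
    by (intro Bochner_Integration.integral_diff integrable_real_mult_indicator A integrable_psi integrable_exp_psi u)
  also have "\<dots> = enn2real (\<integral>\<^sup>+\<omega>. ennreal (psi s (with_drift \<mu> B u \<omega> + c + \<mu> * s)) * indicator A \<omega> \<partial>M) -
    enn2real (\<integral>\<^sup>+\<omega>. ennreal (exp (- 2 * \<mu> * (with_drift \<mu> B u \<omega> + c)) *
        psi s (\<mu> * s - (with_drift \<mu> B u \<omega> + c))) * indicator A \<omega> \<partial>M)"
    by (intro arg_cong2[where f = "(-)"] 1) (auto simp: psi_nonneg)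
  finally show ?thesis .
qed

text \<open>The discrete martingale property: remaining time grows by \<open>h\<close> as the
  observation time moves back by \<open>h\<close>. The event stops at index \<open>k\<close> on both
  sides, so it is determined before the last step. The constant \<open>c\<close> leaves room for the
  level \<open>- y\<close> and for the shift \<epsilon>.\<close>

lemma expectation_survival_step:
  assumes a: "0 < a" and h: "0 < h" and s: "0 \<le> s"
  shows "expectation (\<lambda>\<omega>. survival \<mu> s (with_drift \<mu> B (a + real (Suc k) * h) \<omega> + c) * indicator (grid_above \<mu> y a h k) \<omega>) =
    expectation (\<lambda>\<omega>. survival \<mu> (s + h) (with_drift \<mu> B (a + real k * h) \<omega> + c) * indicator (grid_above \<mu> y a h k) \<omega>)"
proof -
  have pos: "0 < a + real j * h" for j using a h by (simp add: add_pos_nonneg)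
  have A: "grid_above \<mu> y a h k \<in> sets M" using a h by simp
  have 1: "(\<integral>\<^sup>+d. ennreal (normal_density 0 (sqrt h) d) * ennreal (psi s (x + \<mu> * h + d + c + \<mu> * s)) \<partial>lborel) =
      ennreal (psi (s + h) (x + c + \<mu> * (s + h)))" for x
    using psi_step[OF s h, of "x + c + \<mu> * (s + h)"] by (simp add: algebra_simps)
  have 2: "(\<integral>\<^sup>+d. ennreal (normal_density 0 (sqrt h) d) * ennreal (exp (- 2 * \<mu> * (x + \<mu> * h + d + c)) *
        psi s (\<mu> * s - (x + \<mu> * h + d + c))) \<partial>lborel) =
      ennreal (exp (- 2 * \<mu> * (x + c)) * psi (s + h) (\<mu> * (s + h) - (x + c)))" for x
    using exp_psi_step[OF s h, of \<mu> "x + c"] by (simp add: add_ac)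
  show ?thesis
    unfolding expectation_survival_indicator[OF pos A]
    using nn_integral_grid_above_step[OF a h, of "\<lambda>x. ennreal (psi s (x + c + \<mu> * s))" \<mu> k y]
      nn_integral_grid_above_step[OF a h, of "\<lambda>x. ennreal (exp (- 2 * \<mu> * (x + c)) * psi s (\<mu> * s - (x + c)))" \<mu> k y]
    by (simp only: 1 2) simp
qed

text \<open>The sequence \<open>e k\<close> increases: passing from index \<open>k\<close> to
  \<open>Suc k\<close> discards only paths that are then at or below \<open>y\<close>, where the
  survival function is nonpositive. At \<open>k = n\<close> it is at most the probability, since
  \<open>survival\<close> never exceeds 1.\<close>

lemma survival_le_prob_grid_above:
  assumes a: "0 < a" and h: "0 < h"
  shows "expectation (\<lambda>\<omega>. survival \<mu> (real n * h) (with_drift \<mu> B a \<omega> - y) * indicator (grid_above \<mu> y a h 0) \<omega>)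
    \<le> prob (grid_above \<mu> y a h n)"
proof -
  define e where "e k = expectation (\<lambda>\<omega>. survival \<mu> (real (n - k) * h)
      (with_drift \<mu> B (a + real k * h) \<omega> + (- y)) * indicator (grid_above \<mu> y a h k) \<omega>)" for k
  have pos: "0 < a + real j * h" for j using a h by (simp add: add_pos_nonneg)
  have A: "grid_above \<mu> y a h j \<in> sets M" for j using a h by simp
  have step: "e k \<le> e (Suc k)" if "k < n" for k
  proof -
    define s where "s = real (n - Suc k) * h"
    have s: "0 \<le> s" "s + h = real (n - k) * h"
      using that h by (simp_all add: s_def) (simp add: of_nat_diff algebra_simps)
    have "e k = expectation (\<lambda>\<omega>. survival \<mu> s (with_drift \<mu> B (a + real (Suc k) * h) \<omega> + (- y)) * indicator (grid_above \<mu> y a h k) \<omega>)"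
      unfolding e_def s(2)[symmetric] expectation_survival_step[OF a h s(1)] ..
    also have "\<dots> \<le> e (Suc k)"
      unfolding e_def s_def[symmetric]
    proof (intro integral_mono integrable_real_mult_indicator integrable_survival A pos)
      fix \<omega> assume "\<omega> \<in> space M"
      show "survival \<mu> s (with_drift \<mu> B (a + real (Suc k) * h) \<omega> + (- y)) * indicator (grid_above \<mu> y a h k) \<omega>
        \<le> survival \<mu> s (with_drift \<mu> B (a + real (Suc k) * h) \<omega> + (- y)) * indicator (grid_above \<mu> y a h (Suc k)) \<omega>"
      proof (cases "\<omega> \<in> grid_above \<mu> y a h k \<and> \<omega> \<notin> grid_above \<mu> y a h (Suc k)")
        case True
        then have "with_drift \<mu> B (a + real (Suc k) * h) \<omega> \<le> y"
          by (auto simp: grid_above_def le_Suc_eq simp del: of_nat_Suc)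
        with True show ?thesis using survival_nonpos[OF s(1)] by simp
      next
        case False
        moreover have "\<omega> \<in> grid_above \<mu> y a h (Suc k) \<Longrightarrow> \<omega> \<in> grid_above \<mu> y a h k"
          by (auto simp: grid_above_def)
        ultimately show ?thesis by (auto simp: indicator_def)
      qed
    qed
    finally show ?thesis .
  qed
  have "e 0 \<le> e k" if "k \<le> n" for k
    using that step by (induction k) (auto intro: order_trans)
  then have "e 0 \<le> e n" by simp
  also have "e n \<le> expectation (indicator (grid_above \<mu> y a h n))"
    unfolding e_def
  proof (intro integral_mono integrable_real_mult_indicator integrable_survival A pos)
    show "survival \<mu> (real (n - n) * h) x * indicator (grid_above \<mu> y a h n) \<omega> \<le> indicator (grid_above \<mu> y a h n) \<omega>" for x \<omega>
      using survival_le_1 by (auto simp: indicator_def)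
  qed (use A in \<open>auto simp: emeasure_eq_measure\<close>)
  also have "\<dots> = prob (grid_above \<mu> y a h n)" using A by simp
  finally show ?thesis by (simp add: e_def)
qed

text \<open>With the level shifted by \<open>\<epsilon>\<close> the survival function is nonnegative wherever the path leaves
  the half-line by a step shorter than \<open>\<epsilon>\<close>; longer steps are controlled by Chernoff's bound.\<close>

lemma prob_grid_above_le:
  assumes a: "0 < a" and h: "0 < h" and \<epsilon>: "0 < \<epsilon>" and l: "0 \<le> l"
  shows "prob (grid_above \<mu> y a h n) \<le>
    expectation (\<lambda>\<omega>. survival \<mu> (real n * h) (with_drift \<mu> B a \<omega> - y + \<epsilon>) * indicator (grid_above \<mu> y a h 0) \<omega>) +
      real n * exp (- l * \<epsilon> - (l + 2 * \<bar>\<mu>\<bar>) * \<mu> * h + (l + 2 * \<bar>\<mu>\<bar>)\<^sup>2 * h / 2)"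
proof -
  define e where "e k = expectation (\<lambda>\<omega>. survival \<mu> (real (n - k) * h)
      (with_drift \<mu> B (a + real k * h) \<omega> + (- y + \<epsilon>)) * indicator (grid_above \<mu> y a h k) \<omega>)" for k
  define r where "r = exp (- l * \<epsilon> - (l + 2 * \<bar>\<mu>\<bar>) * \<mu> * h + (l + 2 * \<bar>\<mu>\<bar>)\<^sup>2 * h / 2)"
  have pos: "0 < a + real j * h" for j using a h by (simp add: add_pos_nonneg)
  have A: "grid_above \<mu> y a h j \<in> sets M" for j using a h by simp
  have step: "e (Suc k) \<le> e k + r" if "k < n" for k
  proof -
    define s where "s = real (n - Suc k) * h"
    \<comment> \<open>The part \<open>2 * \<bar>\<mu>\<bar>\<close> pays for the exponential growth
      of \<open>survival\<close> below zero, and \<open>l\<close> produces the small factor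
      \<open>exp (- l * \<epsilon>)\<close>; \<open>r\<close> is the resulting exponential moment of
      one step.\<close>
    define L where "L = l + 2 * \<bar>\<mu>\<bar>"
    have s: "0 \<le> s" "s + h = real (n - k) * h"
      using that h by (simp_all add: s_def) (simp add: of_nat_diff algebra_simps)
    let ?X = "\<lambda>j \<omega>. with_drift \<mu> B (a + real j * h) \<omega>"
    let ?R = "\<lambda>\<omega>. exp (- l * \<epsilon>) * exp (- L * (?X (Suc k) \<omega> - ?X k \<omega>))"
    have le: "0 \<le> a + real k * h" "a + real k * h < a + real (Suc k) * h"
      using a h by (auto simp: algebra_simps)
    have R: "integrable M ?R" "expectation ?R = r"
    proof -
      show "integrable M ?R" by (intro integrable_mult_right integrable_exp_increment le)
      have "a + real (Suc k) * h - (a + real k * h) = h" by (simp add: algebra_simps)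
      then have "expectation ?R = exp (- l * \<epsilon>) * exp (- L * \<mu> * h + (- L)\<^sup>2 * h / 2)"
        by (simp only: integral_mult_right_zero integrable_exp_increment(2)[OF le])
      also have "\<dots> = exp (- l * \<epsilon> - L * \<mu> * h + L\<^sup>2 * h / 2)"
        by (simp add: mult_exp_exp)
      finally show "expectation ?R = r" by (simp only: r_def L_def)
    qed
    have "e (Suc k) \<le> expectation (\<lambda>\<omega>. survival \<mu> s (?X (Suc k) \<omega> + (- y + \<epsilon>)) * indicator (grid_above \<mu> y a h k) \<omega> + ?R \<omega>)"
      unfolding e_def s_def[symmetric]
    proof (intro integral_mono integrable_real_mult_indicator integrable_survival A pos Bochner_Integration.integrable_add R(1))
      fix \<omega> assume \<omega>: "\<omega> \<in> space M"
      show "survival \<mu> s (?X (Suc k) \<omega> + (- y + \<epsilon>)) * indicator (grid_above \<mu> y a h (Suc k)) \<omega>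
        \<le> survival \<mu> s (?X (Suc k) \<omega> + (- y + \<epsilon>)) * indicator (grid_above \<mu> y a h k) \<omega> + ?R \<omega>"
      proof (cases "\<omega> \<in> grid_above \<mu> y a h k \<and> \<omega> \<notin> grid_above \<mu> y a h (Suc k)")
        case True
        then have up: "y < ?X k \<omega>"
          by (auto simp: grid_above_def)
        have "0 \<le> survival \<mu> s (?X (Suc k) \<omega> + (- y + \<epsilon>)) + ?R \<omega>"
        proof (cases "?X (Suc k) \<omega> + (- y + \<epsilon>) \<ge> 0")
          case True
          show ?thesis by (intro add_nonneg_nonneg survival_nonneg s(1) True) simp
        next
          case False
          define p where "p = ?X (Suc k) \<omega> + (- y + \<epsilon>)"
          define \<Delta> where "\<Delta> = ?X (Suc k) \<omega> - ?X k \<omega>"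
          \<comment> \<open>The path was above \<open>y\<close> before the step, so ending at least
            \<epsilon> below \<open>y\<close> forces a downward step longer than \<epsilon>, and
            \<open>\<Delta>\<close> lies below \<open>p\<close> by at least \<epsilon>. Thus
            \<open>- p\<close> may be replaced by \<open>- \<Delta>\<close>, and
            \<open>l * (- \<Delta> - \<epsilon>)\<close> is a nonnegative addition to the
            exponent.\<close>
          have p: "p < 0" "\<Delta> + \<epsilon> \<le> p" using False up by (auto simp: p_def \<Delta>_def)
          have "- 2 * \<mu> * p \<le> 2 * \<bar>\<mu>\<bar> * (- p)"
            using p(1) abs_ge_minus_self[of "\<mu> * p"] by (simp add: abs_mult)
          also have "\<dots> \<le> 2 * \<bar>\<mu>\<bar> * (- \<Delta>)"
            using p(2) \<epsilon> by (intro mult_left_mono) auto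
          also have "\<dots> \<le> 2 * \<bar>\<mu>\<bar> * (- \<Delta>) + l * (- \<Delta> - \<epsilon>)"
            using p l by (simp add: mult_nonneg_nonneg)
          also have "\<dots> = - l * \<epsilon> + - L * \<Delta>"
            by (simp add: L_def algebra_simps)
          finally have "exp (- 2 * \<mu> * p) \<le> exp (- l * \<epsilon>) * exp (- L * \<Delta>)"
            by (simp add: mult_exp_exp)
          then show ?thesis
            using survival_ge[of \<mu> p s] unfolding p_def \<Delta>_def by linarith
        qed
        with True show ?thesis by simp
      next
        case False
        moreover have "\<omega> \<in> grid_above \<mu> y a h (Suc k) \<Longrightarrow> \<omega> \<in> grid_above \<mu> y a h k"
          by (auto simp: grid_above_def)
        ultimately show ?thesis by (auto simp: indicator_def)
      qed
    qed
    also have "\<dots> = expectation (\<lambda>\<omega>. survival \<mu> s (?X (Suc k) \<omega> + (- y + \<epsilon>)) * indicator (grid_above \<mu> y a h k) \<omega>) + r"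
      unfolding R(2)[symmetric]
      by (intro Bochner_Integration.integral_add integrable_real_mult_indicator integrable_survival A pos R(1))
    also have "expectation (\<lambda>\<omega>. survival \<mu> s (?X (Suc k) \<omega> + (- y + \<epsilon>)) * indicator (grid_above \<mu> y a h k) \<omega>) = e k"
      unfolding e_def s(2)[symmetric] expectation_survival_step[OF a h s(1)] ..
    finally show ?thesis .
  qed
  have bound: "e k \<le> e 0 + real k * r" if "k \<le> n" for k
    using that
  proof (induction k)
    case (Suc k)
    then show ?case using step[of k] by (simp add: algebra_simps)
  qed simp
  have "prob (grid_above \<mu> y a h n) = expectation (indicator (grid_above \<mu> y a h n))" using A by simp
  \<comment> \<open>No time remains at \<open>k = n\<close>, and the argument exceeds \<epsilon> on
    the event, so the survival function equals 1 there.\<close>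
  also have "\<dots> = e n"
    unfolding e_def
  proof (intro Bochner_Integration.integral_cong refl)
    fix \<omega>
    show "indicator (grid_above \<mu> y a h n) \<omega> = survival \<mu> (real (n - n) * h)
        (with_drift \<mu> B (a + real n * h) \<omega> + (- y + \<epsilon>)) * indicator (grid_above \<mu> y a h n) \<omega>"
    proof (cases "\<omega> \<in> grid_above \<mu> y a h n")
      case True
      then have "y < with_drift \<mu> B (a + real n * h) \<omega>" by (auto simp: grid_above_def)
      then show ?thesis using \<epsilon> by (simp add: survival_0)
    qed simp
  qed
  also have "\<dots> \<le> e 0 + real n * r" using bound by simp
  also have "e 0 = expectation (\<lambda>\<omega>. survival \<mu> (real n * h) (with_drift \<mu> B a \<omega> - y + \<epsilon>) * indicator (grid_above \<mu> y a h 0) \<omega>)"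
    by (simp add: e_def algebra_simps)
  finally show ?thesis by (simp add: r_def)
qed

end

section \<open>Refining the grid\<close>

text \<open>A continuous path positive on a compact interval has a positive minimum, hence a uniform
  gap \<open>1 / real (Suc m)\<close> that can be tested on a countable dense set. Strict positivity
  on the dense set alone would not exclude a zero elsewhere.\<close>

lemma sets_continuous_pos:
  fixes Y :: "real \<Rightarrow> 'a \<Rightarrow> real"
  assumes Y: "\<And>s. s \<in> {a..b} \<Longrightarrow> Y s \<in> borel_measurable M"
    and cont: "\<And>\<omega>. \<omega> \<in> space M \<Longrightarrow> continuous_on {a..b} (\<lambda>s. Y s \<omega>)"
  shows "{\<omega> \<in> space M. \<forall>s\<in>{a..b}. 0 < Y s \<omega>} \<in> sets M"
proof -
  obtain D where D: "countable D" "D \<subseteq> {a..b}" "{a..b} \<subseteq> closure D"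
    using separable[of "{a..b}"] by blast
  have cl: "closure D = {a..b}"
    using D closure_minimal[OF D(2)] by auto
  have "(\<forall>s\<in>{a..b}. 0 < Y s \<omega>) \<longleftrightarrow> (\<exists>m. \<forall>r\<in>D. 1 / real (Suc m) \<le> Y r \<omega>)" if \<omega>: "\<omega> \<in> space M" for \<omega>
  proof
    assume pos: "\<forall>s\<in>{a..b}. 0 < Y s \<omega>"
    show "\<exists>m. \<forall>r\<in>D. 1 / real (Suc m) \<le> Y r \<omega>"
    proof (cases "{a..b} = {}")
      case False
      then obtain s where s: "s \<in> {a..b}" "\<And>r. r \<in> {a..b} \<Longrightarrow> Y s \<omega> \<le> Y r \<omega>"
        using continuous_attains_inf[OF compact_Icc _ cont[OF \<omega>]] by blast
      then obtain m where "1 / real (Suc m) < Y s \<omega>"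
        using pos nat_approx_posE by metis
      then show ?thesis
        using s(2) D(2) by (intro exI[of _ m] ballI) (meson less_le_trans less_imp_le subsetD)
    qed (use D in auto)
  next
    assume "\<exists>m. \<forall>r\<in>D. 1 / real (Suc m) \<le> Y r \<omega>"
    then obtain m where m: "\<And>r. r \<in> D \<Longrightarrow> 1 / real (Suc m) \<le> Y r \<omega>" by blast
    show "\<forall>s\<in>{a..b}. 0 < Y s \<omega>"
    proof
      fix s assume "s \<in> {a..b}"
      then have "1 / real (Suc m) \<le> Y s \<omega>"
        using continuous_ge_on_closure[of D "\<lambda>s. Y s \<omega>" s "1 / real (Suc m)"] cont[OF \<omega>] m by (simp add: cl)
      then show "0 < Y s \<omega>" by (rule less_le_trans[rotated]) simp
    qed
  qed
  then have "{\<omega> \<in> space M. \<forall>s\<in>{a..b}. 0 < Y s \<omega>} = {\<omega> \<in> space M. \<exists>m. \<forall>r\<in>D. 1 / real (Suc m) \<le> Y r \<omega>}"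
    by auto
  also have "\<dots> \<in> sets M"
    using Y D(2)
    by (intro sets.sets_Collect_countable_Ex sets.sets_Collect_countable_All' D(1) borel_measurable_le) auto
  finally show ?thesis .
qed

context standard_brownian_motion
begin

lemma continuous_on_with_drift: "\<omega> \<in> space M \<Longrightarrow> S \<subseteq> {0..} \<Longrightarrow> continuous_on S (\<lambda>s. with_drift \<mu> B s \<omega>)"
  unfolding with_drift_def
  by (intro continuous_intros continuous_on_subset[OF continuous_paths]) auto

lemma sets_with_drift_pos:
  assumes "0 \<le> a"
  shows "{\<omega> \<in> space M. \<forall>s\<in>{a..b}. 0 < with_drift \<mu> B s \<omega>} \<in> sets M"
  using assms by (intro sets_continuous_pos continuous_on_with_drift) auto

text \<open>Serves both bounds, with only \<open>e\<close> or only \<open>y\<close> different from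
  zero. On the event the argument of \<open>survival\<close> is positive, so 1 dominates.
  Nonnegativity of \<open>y m\<close> makes the indicators converge also at \<open>X a = 0\<close>,
  where all of them vanish.\<close>

lemma tendsto_expectation_survival:
  fixes y e :: "nat \<Rightarrow> real"
  assumes a: "0 < a" and T: "0 < T" and y: "y \<longlonglongrightarrow> 0" "\<And>m. 0 \<le> y m" and e: "e \<longlonglongrightarrow> 0" "\<And>m. 0 \<le> e m"
  shows "(\<lambda>m. expectation (\<lambda>\<omega>. survival \<mu> T (with_drift \<mu> B a \<omega> - y m + e m) *
        indicator {\<omega> \<in> space M. y m < with_drift \<mu> B a \<omega>} \<omega>)) \<longlonglongrightarrow>
    expectation (\<lambda>\<omega>. survival \<mu> T (with_drift \<mu> B a \<omega>) * indicator {\<omega> \<in> space M. 0 < with_drift \<mu> B a \<omega>} \<omega>)"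
proof (rule integral_dominated_convergence[where w = "\<lambda>_. 1"])
  have [measurable]: "with_drift \<mu> B a \<in> borel_measurable M" using a by simp
  show "(\<lambda>\<omega>. survival \<mu> T (with_drift \<mu> B a \<omega>) * indicator {\<omega> \<in> space M. 0 < with_drift \<mu> B a \<omega>} \<omega>) \<in> borel_measurable M"
    by measurable
  show "(\<lambda>\<omega>. survival \<mu> T (with_drift \<mu> B a \<omega> - y m + e m) *
        indicator {\<omega> \<in> space M. y m < with_drift \<mu> B a \<omega>} \<omega>) \<in> borel_measurable M" for m
    by measurable
  show "AE \<omega> in M. norm (survival \<mu> T (with_drift \<mu> B a \<omega> - y m + e m) *
        indicator {\<omega> \<in> space M. y m < with_drift \<mu> B a \<omega>} \<omega>) \<le> 1" for m
  proof (rule AE_I2)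
    fix \<omega> assume "\<omega> \<in> space M"
    show "norm (survival \<mu> T (with_drift \<mu> B a \<omega> - y m + e m) *
        indicator {\<omega> \<in> space M. y m < with_drift \<mu> B a \<omega>} \<omega>) \<le> 1"
    proof (cases "y m < with_drift \<mu> B a \<omega>")
      case True
      then have "0 \<le> survival \<mu> T (with_drift \<mu> B a \<omega> - y m + e m)"
        using T e(2)[of m] by (intro survival_nonneg) auto
      then show ?thesis using survival_le_1[of \<mu> T] by (auto simp: indicator_def)
    qed simp
  qed
  show "AE \<omega> in M. (\<lambda>m. survival \<mu> T (with_drift \<mu> B a \<omega> - y m + e m) *
        indicator {\<omega> \<in> space M. y m < with_drift \<mu> B a \<omega>} \<omega>) \<longlonglongrightarrow>
      survival \<mu> T (with_drift \<mu> B a \<omega>) * indicator {\<omega> \<in> space M. 0 < with_drift \<mu> B a \<omega>} \<omega>"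
  proof (rule AE_I2)
    fix \<omega> assume \<omega>: "\<omega> \<in> space M"
    define x where "x = with_drift \<mu> B a \<omega>"
    have "isCont (survival \<mu> T) x"
      using continuous_on_survival[OF T, of UNIV \<mu>] by (simp add: continuous_on_eq_continuous_at)
    moreover have "(\<lambda>m. x - y m + e m) \<longlonglongrightarrow> x - 0 + 0"
      by (intro tendsto_intros y e)
    ultimately have lim: "(\<lambda>m. survival \<mu> T (x - y m + e m)) \<longlonglongrightarrow> survival \<mu> T x"
      using isCont_tendsto_compose by fastforce
    have "\<forall>\<^sub>F m in sequentially. indicator {\<omega> \<in> space M. y m < with_drift \<mu> B a \<omega>} \<omega> =
        (indicator {\<omega> \<in> space M. 0 < with_drift \<mu> B a \<omega>} \<omega> :: real)"
    proof (cases "0 < x")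
      case True
      show ?thesis
        using order_tendstoD(2)[OF y(1) True] by eventually_elim (use True \<omega> in \<open>auto simp: x_def\<close>)
    next
      case False
      then have "\<not> y m < x" for m using y(2)[of m] by simp
      then show ?thesis using False by (auto simp: x_def)
    qed
    then have "(\<lambda>m. indicator {\<omega> \<in> space M. y m < with_drift \<mu> B a \<omega>} \<omega>) \<longlonglongrightarrow>
        (indicator {\<omega> \<in> space M. 0 < with_drift \<mu> B a \<omega>} \<omega> :: real)"
      by (rule tendsto_eventually)
    with lim show "(\<lambda>m. survival \<mu> T (with_drift \<mu> B a \<omega> - y m + e m) *
        indicator {\<omega> \<in> space M. y m < with_drift \<mu> B a \<omega>} \<omega>) \<longlonglongrightarrow>
      survival \<mu> T (with_drift \<mu> B a \<omega>) * indicator {\<omega> \<in> space M. 0 < with_drift \<mu> B a \<omega>} \<omega>"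
      unfolding x_def by (rule tendsto_mult)
  qed
qed simp

lemma grid_above_0: "grid_above \<mu> y a h 0 = {\<omega> \<in> space M. y < with_drift \<mu> B a \<omega>}"
  by (simp add: grid_above_def)

text \<open>The positive level leaves room: a path outside \<open>?E\<close> has a value at most 0,
  hence stays below \<open>y\<close> on a whole neighbourhood, which a fine enough grid must meet.
  At level 0 a path that merely touches zero could be missed by every grid.\<close>

lemma prob_grid_above_diff_tendsto_0:
  assumes a: "0 < a" and T: "0 < T" and y: "0 < y"
  shows "(\<lambda>n. prob (grid_above \<mu> y a (T / real (Suc n)) (Suc n) -
      {\<omega> \<in> space M. \<forall>s\<in>{a..a + T}. 0 < with_drift \<mu> B s \<omega>})) \<longlonglongrightarrow> 0"
proof -
  let ?E = "{\<omega> \<in> space M. \<forall>s\<in>{a..a + T}. 0 < with_drift \<mu> B s \<omega>}"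
  let ?A = "\<lambda>n. grid_above \<mu> y a (T / real (Suc n)) (Suc n)"
  have A: "?A n - ?E \<in> sets M" for n
    using a T by (intro sets.Diff sets_with_drift_pos grid_above_sets) auto
  have "(\<lambda>n. expectation (\<lambda>\<omega>. indicator (?A n - ?E) \<omega>)) \<longlonglongrightarrow> expectation (\<lambda>_. 0 :: real)"
  proof (rule integral_dominated_convergence[where w = "\<lambda>_. 1"])
    show "AE \<omega> in M. (\<lambda>n. indicator (?A n - ?E) \<omega>) \<longlonglongrightarrow> (0 :: real)"
    proof (rule AE_I2)
      fix \<omega> assume \<omega>: "\<omega> \<in> space M"
      show "(\<lambda>n. indicator (?A n - ?E) \<omega>) \<longlonglongrightarrow> (0 :: real)"
      proof (cases "\<omega> \<in> ?E")
        case False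
        then obtain s where s: "a \<le> s" "s \<le> a + T" "with_drift \<mu> B s \<omega> < y"
          using \<omega> y by force
        have "continuous_on {0..} (\<lambda>s. with_drift \<mu> B s \<omega>)"
          by (intro continuous_on_with_drift \<omega>) auto
        moreover have "s \<in> {0..}" "0 < y - with_drift \<mu> B s \<omega>" using s a by auto
        ultimately have "\<exists>d>0. \<forall>u\<in>{0..}. dist u s < d \<longrightarrow>
            dist (with_drift \<mu> B u \<omega>) (with_drift \<mu> B s \<omega>) < y - with_drift \<mu> B s \<omega>"
          unfolding continuous_on_iff by blast
        then obtain d where d: "0 < d" "\<And>u. 0 \<le> u \<Longrightarrow> dist u s < d \<Longrightarrow>
            dist (with_drift \<mu> B u \<omega>) (with_drift \<mu> B s \<omega>) < y - with_drift \<mu> B s \<omega>"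
          by auto
        have "(\<lambda>n. T / real (Suc n)) \<longlonglongrightarrow> 0"
          by real_asymp
        then have "\<forall>\<^sub>F n in sequentially. T / real (Suc n) < d"
          using d(1) by (rule order_tendstoD)
        then have "\<forall>\<^sub>F n in sequentially. indicator (?A n - ?E) \<omega> = (0 :: real)"
        proof eventually_elim
          case (elim n)
          define h where "h = T / real (Suc n)"
          define j where "j = nat \<lfloor>(s - a) / h\<rfloor>"
          have h: "0 < h" "real (Suc n) * h = T" using T by (auto simp: h_def)
          have j: "real j * h \<le> s - a" "s - a < (real j + 1) * h"
          proof -
            have "real j = of_int \<lfloor>(s - a) / h\<rfloor>"
              using s h by (simp add: j_def)
            then have "real j \<le> (s - a) / h" "(s - a) / h < real j + 1"
              by linarith+
            then show "real j * h \<le> s - a" "s - a < (real j + 1) * h"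
              using h by (auto simp: field_simps)
          qed
          have "real j * h \<le> real (Suc n) * h" using j s h by linarith
          then have "j \<le> Suc n" using h(1) by (simp only: mult_le_cancel_right_pos of_nat_le_iff)
          moreover have "dist (a + real j * h) s < d"
            using j elim[folded h_def] by (simp add: dist_real_def algebra_simps)
          then have "with_drift \<mu> B (a + real j * h) \<omega> < y"
            using d(2)[of "a + real j * h"] a h by (auto simp: dist_real_def)
          ultimately have "\<omega> \<notin> ?A n"
            unfolding grid_above_def h_def[symmetric] by auto
          then show ?case by simp
        qed
        then show ?thesis by (rule tendsto_eventually)
      qed simp
    qed
    show "AE \<omega> in M. norm (indicator (?A n - ?E) \<omega> :: real) \<le> 1" for n
      by (auto simp: indicator_def)
    show "(\<lambda>\<omega>. indicator (?A n - ?E) \<omega> :: real) \<in> borel_measurable M" for n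
      using A[of n] by simp
  qed simp_all
  then show ?thesis using A by simp
qed

text \<open>Two limits are nested: the mesh tends to 0 for fixed \<open>m\<close>, and then
  \<open>y m\<close> tends to 0. The upper bound keeps the grid level at 0 and uses
  \<open>y m\<close> as the shift \<epsilon>; the lower bound uses \<open>y m\<close> as the grid
  level.\<close>

lemma prob_with_drift_pos:
  assumes a: "0 < a" and T: "0 < T"
  shows "prob {\<omega> \<in> space M. \<forall>s\<in>{a..a + T}. 0 < with_drift \<mu> B s \<omega>} =
    expectation (\<lambda>\<omega>. survival \<mu> T (with_drift \<mu> B a \<omega>) * indicator {\<omega> \<in> space M. 0 < with_drift \<mu> B a \<omega>} \<omega>)"
    (is "prob ?E = ?G")
proof (rule antisym)
  let ?e = "\<lambda>y e. expectation (\<lambda>\<omega>. survival \<mu> T (with_drift \<mu> B a \<omega> - y + e) *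
        indicator {\<omega> \<in> space M. y < with_drift \<mu> B a \<omega>} \<omega>)"
  have E: "?E \<in> sets M" using a by (intro sets_with_drift_pos) auto
  define y where "y m = 1 / real (Suc m)" for m
  have y: "y \<longlonglongrightarrow> 0" "0 < y m" for m
  proof -
    show "y \<longlonglongrightarrow> 0" unfolding y_def by real_asymp
  qed (simp add: y_def)
  have h: "0 < T / real (Suc n)" "real (Suc n) * (T / real (Suc n)) = T" for n using T by auto
  show "prob ?E \<le> ?G"
  proof (rule LIMSEQ_le_const)
    show "(\<lambda>m. ?e 0 (y m)) \<longlonglongrightarrow> ?G"
      using tendsto_expectation_survival[OF a T _ _ y(1), of "\<lambda>_. 0" \<mu>] less_imp_le[OF y(2)] by simp
    show "\<exists>N. \<forall>m\<ge>N. prob ?E \<le> ?e 0 (y m)"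
    proof (intro exI[of _ 0] allI impI)
      fix m
      \<comment> \<open>The Chernoff parameter is the square root of the number of steps: its square
        times the mesh stays bounded, while \<open>l * y m\<close> still grows fast enough to beat
        the factor \<open>real (Suc n)\<close>.\<close>
      let ?r = "\<lambda>n. real (Suc n) * exp (- sqrt (real (Suc n)) * y m - (sqrt (real (Suc n)) + 2 * \<bar>\<mu>\<bar>) * \<mu> * (T / real (Suc n)) +
        (sqrt (real (Suc n)) + 2 * \<bar>\<mu>\<bar>)\<^sup>2 * (T / real (Suc n)) / 2)"
      have "?r \<longlonglongrightarrow> 0"
      proof -
        define c p where "c = \<bar>\<mu>\<bar>" and "p = y m"
        have "0 < p" using y(2) by (simp add: p_def)
        then have "(\<lambda>n. real (Suc n) * exp (- sqrt (real (Suc n)) * p - (sqrt (real (Suc n)) + 2 * c) * \<mu> * (T / real (Suc n)) +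
          (sqrt (real (Suc n)) + 2 * c)\<^sup>2 * (T / real (Suc n)) / 2)) \<longlonglongrightarrow> 0"
          by real_asymp
        then show ?thesis by (simp only: c_def p_def)
      qed
      then have "(\<lambda>n. ?e 0 (y m) + ?r n) \<longlonglongrightarrow> ?e 0 (y m) + 0"
        by (intro tendsto_add tendsto_const)
      moreover have "prob ?E \<le> ?e 0 (y m) + ?r n" for n
      proof -
        have "?E \<subseteq> grid_above \<mu> 0 a (T / real (Suc n)) (Suc n)"
        proof (clarsimp simp: grid_above_def simp del: of_nat_Suc)
          fix \<omega> j assume \<omega>: "\<forall>s\<in>{a..a + T}. 0 < with_drift \<mu> B s \<omega>" "j \<le> Suc n"
          have "real j * (T / real (Suc n)) \<le> real (Suc n) * (T / real (Suc n))"
            using \<omega>(2) T by (intro mult_right_mono) (auto simp del: of_nat_Suc)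
          then have "a + real j * (T / real (Suc n)) \<in> {a..a + T}" using T by simp
          with \<omega>(1) show "0 < with_drift \<mu> B (a + real j * T / real (Suc n)) \<omega>" by simp
        qed
        then have "prob ?E \<le> prob (grid_above \<mu> 0 a (T / real (Suc n)) (Suc n))"
          using a T by (intro finite_measure_mono grid_above_sets) auto
        also have "\<dots> \<le> ?e 0 (y m) + ?r n"
          using prob_grid_above_le[OF a h(1) y(2), of "sqrt (real (Suc n))" \<mu> 0 n "Suc n" m]
          unfolding grid_above_0 h(2) by simp
        finally show ?thesis .
      qed
      ultimately show "prob ?E \<le> ?e 0 (y m)"
        using LIMSEQ_le_const by fastforce
    qed
  qed
  show "?G \<le> prob ?E"
  proof (rule LIMSEQ_le_const2)
    show "(\<lambda>m. ?e (y m) 0) \<longlonglongrightarrow> ?G"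
      using tendsto_expectation_survival[OF a T y(1), of "\<lambda>_. 0" \<mu>] less_imp_le[OF y(2)] by simp
    show "\<exists>N. \<forall>m\<ge>N. ?e (y m) 0 \<le> prob ?E"
    proof (intro exI[of _ 0] allI impI)
      fix m
      let ?A = "\<lambda>n. grid_above \<mu> (y m) a (T / real (Suc n)) (Suc n)"
      have "(\<lambda>n. prob ?E + prob (?A n - ?E)) \<longlonglongrightarrow> prob ?E + 0"
        by (intro tendsto_add tendsto_const prob_grid_above_diff_tendsto_0 a T y(2))
      moreover have "?e (y m) 0 \<le> prob ?E + prob (?A n - ?E)" for n
      proof -
        have A: "?A n \<in> sets M" using a T by (intro grid_above_sets) auto
        have "?e (y m) 0 \<le> prob (?A n)"
          using survival_le_prob_grid_above[OF a h(1)[of n], of \<mu> "Suc n" "y m"]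
          unfolding grid_above_0 h(2) by simp
        also have "\<dots> \<le> prob (?E \<union> (?A n - ?E))"
          using A E by (intro finite_measure_mono) auto
        also have "\<dots> \<le> prob ?E + prob (?A n - ?E)"
          using A E by (intro measure_Un_le) auto
        finally show ?thesis .
      qed
      ultimately show "?e (y m) 0 \<le> prob ?E"
        using LIMSEQ_le_const by fastforce
    qed
  qed
qed

section \<open>The law at a fixed time and the probability of no zero in an interval\<close>

lemma distributed_with_drift:
  assumes a: "0 < a"
  shows "distributed M lborel (with_drift \<mu> B a) (normal_density (\<mu> * a) (sqrt a))"
proof -
  have "distributed M lborel (\<lambda>\<omega>. B a \<omega> - B 0 \<omega>) (normal_density 0 (sqrt a))"
    using normal_increments[of 0 a] a by simp
  then have "distributed M lborel (\<lambda>\<omega>. \<mu> * a + 1 * (B a \<omega> - B 0 \<omega>)) (normal_density (\<mu> * a + 1 * 0) (\<bar>1\<bar> * sqrt a))"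
    using a by (intro normal_density_affine) auto
  moreover have "distr M lborel (\<lambda>\<omega>. \<mu> * a + 1 * (B a \<omega> - B 0 \<omega>)) = distr M lborel (with_drift \<mu> B a)"
    by (intro distr_cong) (auto simp: with_drift_def start)
  ultimately show ?thesis
    using a by (simp add: distributed_def)
qed

lemma AE_with_drift_neq_0:
  assumes t: "0 < t"
  shows "AE \<omega> in M. with_drift \<mu> B t \<omega> \<noteq> 0"
proof -
  have "emeasure M (with_drift \<mu> B t -` {0} \<inter> space M) =
      (\<integral>\<^sup>+x. ennreal (normal_density (\<mu> * t) (sqrt t) x) * indicator {0} x \<partial>lborel)"
    by (rule distributed_emeasure[OF distributed_with_drift[OF t]]) simp
  also have "\<dots> = 0" by (rule nn_integral_null_set) (simp add: null_sets_def)
  finally show ?thesis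
    using t by (intro AE_I[of _ _ "with_drift \<mu> B t -` {0} \<inter> space M"]) auto
qed

lemma emeasure_with_drift_pos:
  assumes a: "0 < a" and T: "0 < T"
  shows "emeasure M {\<omega> \<in> space M. \<forall>s\<in>{a..a + T}. 0 < with_drift \<mu> B s \<omega>} +
      (\<integral>\<^sup>+s. ennreal (1 / (2 * pi) * (1 / (a + s) * sqrt (a / s) * exp (- (\<mu>\<^sup>2 / 2) * (a + s)))) *
          indicator {0<..<T} s \<partial>lborel) =
    emeasure M {\<omega> \<in> space M. 0 < with_drift \<mu> B a \<omega>}"
proof -
  let ?A = "{\<omega> \<in> space M. 0 < with_drift \<mu> B a \<omega>}"
  have [measurable]: "with_drift \<mu> B a \<in> borel_measurable M" using a by simp
  have A: "?A \<in> sets M" by measurable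
  have "emeasure M {\<omega> \<in> space M. \<forall>s\<in>{a..a + T}. 0 < with_drift \<mu> B s \<omega>} =
    ennreal (expectation (\<lambda>\<omega>. survival \<mu> T (with_drift \<mu> B a \<omega>) * indicator ?A \<omega>))"
    by (simp add: emeasure_eq_measure prob_with_drift_pos[OF a T])
  also have "\<dots> = (\<integral>\<^sup>+\<omega>. ennreal (survival \<mu> T (with_drift \<mu> B a \<omega>) * indicator ?A \<omega>) \<partial>M)"
    using integrable_survival[OF a, of \<mu> T 0] T
    by (intro nn_integral_eq_integral[symmetric] integrable_real_mult_indicator A AE_I2)
       (auto simp: indicator_def survival_nonneg)
  also have "\<dots> = (\<integral>\<^sup>+\<omega>. ennreal (survival \<mu> T (with_drift \<mu> B a \<omega>)) * indicator {0<..} (with_drift \<mu> B a \<omega>) \<partial>M)"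
    by (intro nn_integral_cong) (auto simp: indicator_def)
  also have "\<dots> = (\<integral>\<^sup>+x. ennreal (normal_density (\<mu> * a) (sqrt a) x) * (ennreal (survival \<mu> T x) * indicator {0<..} x) \<partial>lborel)"
    by (subst distributed_nn_integral[OF distributed_with_drift[OF a]]) auto
  finally have E: "emeasure M {\<omega> \<in> space M. \<forall>s\<in>{a..a + T}. 0 < with_drift \<mu> B s \<omega>} = \<dots>" .
  have "emeasure M ?A = emeasure M (with_drift \<mu> B a -` {0<..} \<inter> space M)"
    by (intro arg_cong[where f = "emeasure M"]) auto
  also have "\<dots> = (\<integral>\<^sup>+x. ennreal (normal_density (\<mu> * a) (sqrt a) x) * indicator {0<..} x \<partial>lborel)"
    by (rule distributed_emeasure[OF distributed_with_drift[OF a]]) simp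
  finally show ?thesis
    unfolding E using nn_integral_normal_survival[OF a T] by simp
qed

lemma uminus_brownian_motion: "standard_brownian_motion M (\<lambda>s \<omega>. - B s \<omega>)"
proof
  show "0 \<le> s \<Longrightarrow> (\<lambda>\<omega>. - B s \<omega>) \<in> borel_measurable M" for s
    using rv[of s] by measurable
  show "\<omega> \<in> space M \<Longrightarrow> - B 0 \<omega> = 0" for \<omega> by (simp add: start)
  show "\<omega> \<in> space M \<Longrightarrow> continuous_on {0..} (\<lambda>s. - B s \<omega>)" for \<omega>
    by (intro continuous_intros continuous_paths)
  show "distributed M lborel (\<lambda>\<omega>. - B u \<omega> - - B s \<omega>) (normal_density 0 (sqrt (u - s)))"
    if "0 \<le> s" "s < u" for s u
    using normal_density_affine[OF normal_increments[OF that], of "-1" 0] that by simp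
  show "indep_vars (\<lambda>_. borel) (\<lambda>i \<omega>. - B (\<tau> (Suc i)) \<omega> - - B (\<tau> i) \<omega>) {..<n}"
    if "0 \<le> \<tau> 0" "mono_on {..n} \<tau>" for \<tau> :: "nat \<Rightarrow> real" and n
    using indep_vars_compose2[OF indep_increments[OF that], of "\<lambda>_ x. - x" "\<lambda>_. borel"] by simp
qed

lemma sets_no_zero:
  assumes "0 \<le> a"
  shows "{\<omega> \<in> space M. \<forall>s\<in>{a..b}. with_drift \<mu> B s \<omega> \<noteq> 0} \<in> sets M"
proof -
  have "{\<omega> \<in> space M. \<forall>s\<in>{a..b}. 0 < \<bar>with_drift \<mu> B s \<omega>\<bar>} \<in> sets M"
    using assms by (intro sets_continuous_pos continuous_intros continuous_on_with_drift borel_measurable_abs) auto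
  then show ?thesis by simp
qed

text \<open>A continuous path without zero has constant sign. Each sign loses the same mass
  \<open>?J\<close> from the mass of that sign at time \<open>a\<close>, and these two masses add up
  to 1 because \<open>X a \<noteq> 0\<close> almost surely. The total loss \<open>2 * ?J\<close>
  turns \<open>1 / (2 * pi)\<close> into \<open>1 / pi\<close>.\<close>

lemma prob_no_zero:
  assumes a: "0 < a" and b: "a < b"
  shows "ennreal (1 - prob {\<omega> \<in> space M. \<forall>s\<in>{a..b}. with_drift \<mu> B s \<omega> \<noteq> 0}) =
    (\<integral>\<^sup>+s. ennreal (1 / pi * (1 / (a + s) * sqrt (a / s) * exp (- (\<mu>\<^sup>2 / 2) * (a + s)))) * indicator {0<..<b - a} s \<partial>lborel)"
proof -
  interpret neg: standard_brownian_motion M "\<lambda>s \<omega>. - B s \<omega>" by (rule uminus_brownian_motion)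
  let ?X = "with_drift \<mu> B"
  let ?P = "{\<omega> \<in> space M. \<forall>s\<in>{a..b}. 0 < ?X s \<omega>}" and ?N = "{\<omega> \<in> space M. \<forall>s\<in>{a..b}. ?X s \<omega> < 0}"
  let ?p = "{\<omega> \<in> space M. 0 < ?X a \<omega>}" and ?n = "{\<omega> \<in> space M. ?X a \<omega> < 0}"
  let ?g = "\<lambda>s. 1 / (a + s) * sqrt (a / s) * exp (- (\<mu>\<^sup>2 / 2) * (a + s))"
  let ?J = "\<integral>\<^sup>+s. ennreal (1 / (2 * pi) * ?g s) * indicator {0<..<b - a} s \<partial>lborel"
  have neg: "with_drift (- \<mu>) (\<lambda>s \<omega>. - B s \<omega>) s \<omega> = - ?X s \<omega>" for s \<omega>
    by (simp add: with_drift_def)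
  have sets: "?P \<in> sets M" "?N \<in> sets M" "?p \<in> sets M" "?n \<in> sets M"
    using sets_with_drift_pos[of a b \<mu>] neg.sets_with_drift_pos[of a b "- \<mu>"] a by (simp_all add: neg)
  have P: "emeasure M ?P + ?J = emeasure M ?p"
    using emeasure_with_drift_pos[OF a, of "b - a" \<mu>] b by simp
  have N: "emeasure M ?N + ?J = emeasure M ?n"
    using neg.emeasure_with_drift_pos[OF a, of "b - a" "- \<mu>"] b by (simp add: neg)
  have "{\<omega> \<in> space M. \<forall>s\<in>{a..b}. ?X s \<omega> \<noteq> 0} = ?P \<union> ?N"
  proof (intro set_eqI iffI)
    fix \<omega> assume \<omega>: "\<omega> \<in> {\<omega> \<in> space M. \<forall>s\<in>{a..b}. ?X s \<omega> \<noteq> 0}"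
    have cont: "continuous_on {u..v} (\<lambda>s. ?X s \<omega>)" if "u \<in> {a..b}" for u v
      using \<omega> a that by (intro continuous_on_with_drift) auto
    show "\<omega> \<in> ?P \<union> ?N"
    proof (cases "0 < ?X a \<omega>")
      case True
      have "0 < ?X s \<omega>" if s: "s \<in> {a..b}" for s
      proof (rule ccontr)
        assume "\<not> 0 < ?X s \<omega>"
        then obtain x where "a \<le> x" "x \<le> s" "?X x \<omega> = 0"
          using IVT2'[of "\<lambda>s. ?X s \<omega>" s 0 a] True s cont[of a s] by auto
        with \<omega> s show False by auto
      qed
      with \<omega> show ?thesis by auto
    next
      case False
      have "?X s \<omega> < 0" if s: "s \<in> {a..b}" for s
      proof (rule ccontr)
        assume "\<not> ?X s \<omega> < 0"
        then obtain x where "a \<le> x" "x \<le> s" "?X x \<omega> = 0"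
          using IVT'[of "\<lambda>s. ?X s \<omega>" a 0 s] False s cont[of a s] by auto
        with \<omega> s show False by auto
      qed
      with \<omega> show ?thesis by auto
    qed
  qed auto
  then have "prob {\<omega> \<in> space M. \<forall>s\<in>{a..b}. ?X s \<omega> \<noteq> 0} = prob (?P \<union> ?N)" by simp
  also have "\<dots> = prob ?P + prob ?N"
  proof (rule finite_measure_Union)
    have "a \<in> {a..b}" using b by simp
    then show "?P \<inter> ?N = {}" by force
  qed (use sets in auto)
  finally have PN: "prob {\<omega> \<in> space M. \<forall>s\<in>{a..b}. ?X s \<omega> \<noteq> 0} = prob ?P + prob ?N" .
  have "prob ?p + prob ?n = prob (?p \<union> ?n)"
    using sets by (intro finite_measure_Union[symmetric]) auto
  also have "\<dots> = 1"
    using AE_with_drift_neq_0[OF a, of \<mu>] sets by (intro prob_eq_1[THEN iffD2]) auto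
  finally have pn: "prob ?p + prob ?n = 1" .
  \<comment> \<open>Finiteness of \<open>?J\<close> comes from the identity itself, and it allows
    the passage from \<open>ennreal\<close> to real arithmetic.\<close>
  have "?J \<le> emeasure M ?p" unfolding P[symmetric] by simp
  then have "?J < top" using emeasure_finite le_less_trans less_top by blast
  then obtain j where j: "?J = ennreal j" "0 \<le> j"
    unfolding less_top_ennreal by (elim exE conjE)
  have "prob ?P + j = prob ?p" "prob ?N + j = prob ?n"
    using P N j by (simp_all add: emeasure_eq_measure flip: ennreal_plus)
  then have "1 - prob {\<omega> \<in> space M. \<forall>s\<in>{a..b}. ?X s \<omega> \<noteq> 0} = 2 * j"
    using PN pn by simp
  then have "ennreal (1 - prob {\<omega> \<in> space M. \<forall>s\<in>{a..b}. ?X s \<omega> \<noteq> 0}) = 2 * ?J"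
    using j by (simp add: ennreal_mult)
  also have "\<dots> = (\<integral>\<^sup>+s. 2 * (ennreal (1 / (2 * pi) * ?g s) * indicator {0<..<b - a} s) \<partial>lborel)"
    by (subst nn_integral_cmult) auto
  also have "\<dots> = (\<integral>\<^sup>+s. ennreal (1 / pi * ?g s) * indicator {0<..<b - a} s \<partial>lborel)"
  proof (intro nn_integral_cong)
    fix s :: real
    have "2 * ennreal (1 / (2 * pi) * ?g s) = ennreal (2 * (1 / (2 * pi) * ?g s))" if "0 < s"
      using a that by (subst ennreal_mult) auto
    then show "2 * (ennreal (1 / (2 * pi) * ?g s) * indicator {0<..<b - a} s) = ennreal (1 / pi * ?g s) * indicator {0<..<b - a} s"
      by (cases "s \<in> {0<..<b - a}") (simp_all add: mult.assoc[symmetric])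
  qed
  finally show ?thesis .
qed

end

section \<open>The last zero before and the first zero after a fixed time\<close>

lemma last_zero_before_le_iff:
  assumes "X 0 \<omega> = 0" "0 < t"
  shows "last_zero_before X t \<omega> \<le> c \<longleftrightarrow> (\<forall>s. 0 \<le> s \<and> s < t \<and> X s \<omega> = 0 \<longrightarrow> s \<le> c)"
proof -
  have "0 \<in> {s. 0 \<le> s \<and> s < t \<and> X s \<omega> = 0}" using assms by simp
  then have "{s. 0 \<le> s \<and> s < t \<and> X s \<omega> = 0} \<noteq> {}" by blast
  moreover have "bdd_above {s. 0 \<le> s \<and> s < t \<and> X s \<omega> = 0}"
    by (rule bdd_aboveI[of _ t]) auto
  ultimately show ?thesis
    unfolding last_zero_before_def by (subst cSup_le_iff) auto
qed

lemma le_first_zero_after_iff: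
  "c \<le> first_zero_after X t \<omega> \<longleftrightarrow> (\<forall>s. t < s \<and> X s \<omega> = 0 \<longrightarrow> c \<le> ereal s)"
  unfolding first_zero_after_def le_Inf_iff by auto

text \<open>The strict inequalities come from continuity: being nonzero at \<open>a\<close> and
  \<open>b\<close> extends to neighbourhoods, so the supremum and the infimum cannot reach these
  endpoints. A zero at \<open>t\<close> itself is seen by neither of the two times, which is why
  \<open>X t \<omega> \<noteq> 0\<close> is assumed.\<close>

lemma no_zero_iff_last_first:
  assumes cont: "continuous_on {0..} (\<lambda>s. X s \<omega>)" and X0: "X 0 \<omega> = 0" and Xt: "X t \<omega> \<noteq> 0"
    and a: "0 < a" "a < t" and b: "t < b"
  shows "(\<forall>s\<in>{a..b}. X s \<omega> \<noteq> 0) \<longleftrightarrow> last_zero_before X t \<omega> < a \<and> ereal b < first_zero_after X t \<omega>"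
proof
  have t: "0 < t" using a by simp
  have near: "\<exists>d>0. \<forall>u. 0 \<le> u \<and> \<bar>u - s\<bar> < d \<longrightarrow> X u \<omega> \<noteq> 0" if s: "0 \<le> s" "X s \<omega> \<noteq> 0" for s
  proof -
    have "\<exists>d>0. \<forall>u\<in>{0..}. dist u s < d \<longrightarrow> dist (X u \<omega>) (X s \<omega>) < \<bar>X s \<omega>\<bar>"
    proof -
      have "s \<in> {0..}" "0 < \<bar>X s \<omega>\<bar>" using s by auto
      then show ?thesis using cont unfolding continuous_on_iff by blast
    qed
    then obtain d where "0 < d" "\<And>u. 0 \<le> u \<Longrightarrow> \<bar>u - s\<bar> < d \<Longrightarrow> \<bar>X u \<omega> - X s \<omega>\<bar> < \<bar>X s \<omega>\<bar>"
      by (auto simp: dist_real_def)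
    then show ?thesis by (intro exI[of _ d]) force
  qed
  assume nz: "\<forall>s\<in>{a..b}. X s \<omega> \<noteq> 0"
  obtain d where d: "0 < d" "\<And>u. 0 \<le> u \<Longrightarrow> \<bar>u - a\<bar> < d \<Longrightarrow> X u \<omega> \<noteq> 0"
    using near[of a] nz a b by auto
  obtain e where e: "0 < e" "\<And>u. 0 \<le> u \<Longrightarrow> \<bar>u - b\<bar> < e \<Longrightarrow> X u \<omega> \<noteq> 0"
    using near[of b] nz a b by auto
  have "last_zero_before X t \<omega> \<le> a - d"
    unfolding last_zero_before_le_iff[of X, OF X0 t]
  proof (intro allI impI)
    fix s assume s: "0 \<le> s \<and> s < t \<and> X s \<omega> = 0"
    then have "s < a" using nz b by force
    moreover have "\<not> \<bar>s - a\<bar> < d" using d(2)[of s] s by auto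
    ultimately show "s \<le> a - d" by linarith
  qed
  moreover have V: "ereal (b + e) \<le> first_zero_after X t \<omega>"
    unfolding le_first_zero_after_iff
  proof (intro allI impI)
    fix s assume s: "t < s \<and> X s \<omega> = 0"
    then have "b < s" using nz a by force
    moreover have "\<not> \<bar>s - b\<bar> < e" using e(2)[of s] s t by auto
    ultimately show "ereal (b + e) \<le> ereal s" by simp
  qed
  moreover have "ereal b < first_zero_after X t \<omega>"
    by (rule less_le_trans[OF _ V]) (use e(1) in simp)
  ultimately show "last_zero_before X t \<omega> < a \<and> ereal b < first_zero_after X t \<omega>"
    using d(1) by simp
next
  assume *: "last_zero_before X t \<omega> < a \<and> ereal b < first_zero_after X t \<omega>"
  have t: "0 < t" using a by simp
  show "\<forall>s\<in>{a..b}. X s \<omega> \<noteq> 0"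
  proof (intro ballI notI)
    fix s assume s: "s \<in> {a..b}" "X s \<omega> = 0"
    then consider "s < t" | "t < s" using Xt by (cases s t rule: linorder_cases) auto
    then show False
    proof cases
      case 1
      then have "s \<le> last_zero_before X t \<omega>"
        using last_zero_before_le_iff[of X, OF X0 t, of "last_zero_before X t \<omega>"] s a by auto
      then show False using * s by auto
    next
      case 2
      then have "first_zero_after X t \<omega> \<le> ereal s"
        using le_first_zero_after_iff[of "first_zero_after X t \<omega>" X t \<omega>] s by auto
      then have "ereal b < ereal s" using * by (elim conjE) (rule less_le_trans)
      then show False using s by simp
    qed
  qed
qed

section \<open>Measurability of the two times and their joint tail\<close>

context standard_brownian_motion
begin

text \<open>Non-strict bounds on the last and first zero say that there is no zero in an open
  interval ending or starting at \<open>t\<close>. Such an interval is a countable union of compact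
  ones.\<close>

lemma sets_no_zero_open:
  assumes "0 \<le> a"
  shows "{\<omega> \<in> space M. \<forall>s. a < s \<and> s < b \<longrightarrow> with_drift \<mu> B s \<omega> \<noteq> 0} \<in> sets M"
proof -
  have "(\<forall>s. a < s \<and> s < b \<longrightarrow> with_drift \<mu> B s \<omega> \<noteq> 0) \<longleftrightarrow>
      (\<forall>n. \<forall>s\<in>{a + 1 / real (Suc n)..b - 1 / real (Suc n)}. with_drift \<mu> B s \<omega> \<noteq> 0)" for \<omega>
  proof (intro iffI allI impI ballI)
    fix n s
    assume nz: "\<forall>s. a < s \<and> s < b \<longrightarrow> with_drift \<mu> B s \<omega> \<noteq> 0" and "s \<in> {a + 1 / real (Suc n)..b - 1 / real (Suc n)}"
    moreover have "0 < 1 / real (Suc n)" by simp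
    ultimately have "a < s" "s < b" by (simp_all only: atLeastAtMost_iff) linarith+
    with nz show "with_drift \<mu> B s \<omega> \<noteq> 0" by blast
  next
    fix s
    assume nz: "\<forall>n. \<forall>s\<in>{a + 1 / real (Suc n)..b - 1 / real (Suc n)}. with_drift \<mu> B s \<omega> \<noteq> 0"
      and s: "a < s \<and> s < b"
    then have "0 < min (s - a) (b - s)" by simp
    then obtain n where "1 / real (Suc n) < min (s - a) (b - s)" by (rule nat_approx_posE)
    then have "s \<in> {a + 1 / real (Suc n)..b - 1 / real (Suc n)}" by auto
    with nz show "with_drift \<mu> B s \<omega> \<noteq> 0" by blast
  qed
  moreover have "{\<omega> \<in> space M. \<forall>n. \<forall>s\<in>{a + 1 / real (Suc n)..b - 1 / real (Suc n)}. with_drift \<mu> B s \<omega> \<noteq> 0} \<in> sets M"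
    using assms by (intro sets.sets_Collect_countable_All sets_no_zero) auto
  ultimately show ?thesis by simp
qed

lemma measurable_last_zero_before:
  assumes t: "0 < t"
  shows "last_zero_before (with_drift \<mu> B) t \<in> borel_measurable M"
proof (rule borel_measurableI_le)
  fix c :: real
  let ?X = "with_drift \<mu> B"
  have iff: "last_zero_before ?X t \<omega> \<le> c \<longleftrightarrow> (\<forall>s. 0 \<le> s \<and> s < t \<and> ?X s \<omega> = 0 \<longrightarrow> s \<le> c)" if "\<omega> \<in> space M" for \<omega>
    using that t by (intro last_zero_before_le_iff with_drift_0)
  show "{\<omega> \<in> space M. last_zero_before ?X t \<omega> \<le> c} \<in> sets M"
  proof (cases "0 \<le> c")
    case True
    have "(\<forall>s. 0 \<le> s \<and> s < t \<and> ?X s \<omega> = 0 \<longrightarrow> s \<le> c) \<longleftrightarrow> (\<forall>s. c < s \<and> s < t \<longrightarrow> ?X s \<omega> \<noteq> 0)" for \<omega>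
    proof (intro iffI allI impI notI)
      fix s assume "\<forall>s. 0 \<le> s \<and> s < t \<and> ?X s \<omega> = 0 \<longrightarrow> s \<le> c" "c < s \<and> s < t" "?X s \<omega> = 0"
      then show False using True by (auto dest: spec[of _ s])
    next
      fix s assume "\<forall>s. c < s \<and> s < t \<longrightarrow> ?X s \<omega> \<noteq> 0" "0 \<le> s \<and> s < t \<and> ?X s \<omega> = 0"
      then show "s \<le> c" by (auto dest: spec[of _ s])
    qed
    then have "{\<omega> \<in> space M. last_zero_before ?X t \<omega> \<le> c} = {\<omega> \<in> space M. \<forall>s. c < s \<and> s < t \<longrightarrow> ?X s \<omega> \<noteq> 0}"
      by (intro Collect_cong conj_cong refl) (simp only: iff)
    then show ?thesis using sets_no_zero_open[OF True] by simp
  next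
    \<comment> \<open>The path starts at 0, so the last zero is never negative.\<close>
    case False
    then have "{\<omega> \<in> space M. last_zero_before ?X t \<omega> \<le> c} = {}"
      using iff with_drift_0[of _ \<mu>] t by auto
    then show ?thesis by (simp only: sets.empty_sets)
  qed
qed

lemma measurable_first_zero_after:
  assumes t: "0 < t"
  shows "first_zero_after (with_drift \<mu> B) t \<in> borel_measurable M"
  unfolding borel_measurable_iff_Ici_ereal
proof
  fix c :: ereal
  let ?X = "with_drift \<mu> B" and ?V = "first_zero_after (with_drift \<mu> B) t"
  have real: "?V -` {ereal r..} \<inter> space M \<in> sets M" for r
  proof -
    have "?V -` {ereal r..} \<inter> space M = {\<omega> \<in> space M. \<forall>s. t < s \<and> s < r \<longrightarrow> ?X s \<omega> \<noteq> 0}"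
      by (auto simp: le_first_zero_after_iff not_le[symmetric])
    then show ?thesis using sets_no_zero_open[of t r \<mu>] t by simp
  qed
  show "?V -` {c..} \<inter> space M \<in> sets M"
  proof (cases c)
    case PInf
    have "?V -` {c..} \<inter> space M = (\<Inter>n. ?V -` {ereal (real n)..} \<inter> space M)"
      unfolding PInf
    proof (intro set_eqI iffI)
      fix \<omega> assume \<omega>: "\<omega> \<in> (\<Inter>n. ?V -` {ereal (real n)..} \<inter> space M)"
      then have "ereal (real n) \<le> ?V \<omega>" for n by auto
      then have "?V \<omega> = \<infinity>" by (metis ereal_top order.trans ereal_less_eq(3) real_arch_simple)
      with \<omega> show "\<omega> \<in> ?V -` {\<infinity>..} \<inter> space M" by auto
    qed auto
    also have "\<dots> \<in> sets M" using real by (intro sets.countable_INT) auto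
    finally show ?thesis .
  next
    case MInf
    then have "?V -` {c..} \<inter> space M = space M" by auto
    then show ?thesis by simp
  qed (use real in auto)
qed

lemma prob_last_first:
  assumes a: "0 < a" "a < t" and b: "t < b"
  shows "prob {\<omega> \<in> space M. last_zero_before (with_drift \<mu> B) t \<omega> < a \<and> ereal b < first_zero_after (with_drift \<mu> B) t \<omega>} =
    prob {\<omega> \<in> space M. \<forall>s\<in>{a..b}. with_drift \<mu> B s \<omega> \<noteq> 0}"
proof (rule measure_eq_AE)
  have t: "0 < t" using a by simp
  note [measurable] = measurable_last_zero_before[OF t] measurable_first_zero_after[OF t]
  show "{\<omega> \<in> space M. last_zero_before (with_drift \<mu> B) t \<omega> < a \<and> ereal b < first_zero_after (with_drift \<mu> B) t \<omega>} \<in> sets M"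
    by measurable
  show "{\<omega> \<in> space M. \<forall>s\<in>{a..b}. with_drift \<mu> B s \<omega> \<noteq> 0} \<in> sets M"
    using a by (intro sets_no_zero) auto
  show "AE \<omega> in M. \<omega> \<in> {\<omega> \<in> space M. last_zero_before (with_drift \<mu> B) t \<omega> < a \<and> ereal b < first_zero_after (with_drift \<mu> B) t \<omega>}
      \<longleftrightarrow> \<omega> \<in> {\<omega> \<in> space M. \<forall>s\<in>{a..b}. with_drift \<mu> B s \<omega> \<noteq> 0}"
  proof (rule AE_mp[OF AE_with_drift_neq_0[OF t, of \<mu>]], rule AE_I2, rule impI)
    fix \<omega> assume \<omega>: "\<omega> \<in> space M" and "with_drift \<mu> B t \<omega> \<noteq> 0"
    then have "(\<forall>s\<in>{a..b}. with_drift \<mu> B s \<omega> \<noteq> 0) \<longleftrightarrow>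
        last_zero_before (with_drift \<mu> B) t \<omega> < a \<and> ereal b < first_zero_after (with_drift \<mu> B) t \<omega>"
      by (intro no_zero_iff_last_first continuous_on_with_drift with_drift_0 a b) auto
    with \<omega> show "\<omega> \<in> {\<omega> \<in> space M. last_zero_before (with_drift \<mu> B) t \<omega> < a \<and> ereal b < first_zero_after (with_drift \<mu> B) t \<omega>}
      \<longleftrightarrow> \<omega> \<in> {\<omega> \<in> space M. \<forall>s\<in>{a..b}. with_drift \<mu> B s \<omega> \<noteq> 0}"
      by simp
  qed
qed

text \<open>The complementary form in \<open>ennreal\<close> lets integrals over adjacent intervals
  be added without integrability conditions, as the rectangle probabilities require.\<close>

lemma ennreal_prob_last_first:
  assumes "0 < a" "a < t" "t < b"
  shows "ennreal (1 - prob {\<omega> \<in> space M. last_zero_before (with_drift \<mu> B) t \<omega> < a \<and> ereal b < first_zero_after (with_drift \<mu> B) t \<omega>}) =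
    (\<integral>\<^sup>+s. ennreal (1 / pi * (1 / (a + s) * sqrt (a / s) * exp (- (\<mu>\<^sup>2 / 2) * (a + s)))) * indicator {0<..<b - a} s \<partial>lborel)"
  unfolding prob_last_first[OF assms] using assms by (intro prob_no_zero) auto

lemma prob_last_first_eq:
  assumes "0 < a" "a < t" "t < b"
  shows "prob {\<omega> \<in> space M. last_zero_before (with_drift \<mu> B) t \<omega> < a \<and> ereal b < first_zero_after (with_drift \<mu> B) t \<omega>} =
    1 - 1 / pi * (LBINT s:{0<..<b - a}. 1 / (a + s) * sqrt (a / s) * exp (- (\<mu>\<^sup>2 / 2) * (a + s)))"
proof -
  let ?p = "prob {\<omega> \<in> space M. last_zero_before (with_drift \<mu> B) t \<omega> < a \<and> ereal b < first_zero_after (with_drift \<mu> B) t \<omega>}"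
  let ?g = "\<lambda>s. 1 / (a + s) * sqrt (a / s) * exp (- (\<mu>\<^sup>2 / 2) * (a + s))"
  have "1 / pi * (LBINT s:{0<..<b - a}. ?g s) = (\<integral>s. indicator {0<..<b - a} s * (1 / pi * ?g s) \<partial>lborel)"
    unfolding set_lebesgue_integral_def by (subst integral_mult_right_zero[symmetric]) (simp add: mult_ac)
  also have "\<dots> = enn2real (\<integral>\<^sup>+s. ennreal (indicator {0<..<b - a} s * (1 / pi * ?g s)) \<partial>lborel)"
    using assms by (intro integral_eq_nn_integral) (auto simp: indicator_def)
  also have "(\<integral>\<^sup>+s. ennreal (indicator {0<..<b - a} s * (1 / pi * ?g s)) \<partial>lborel) =
    (\<integral>\<^sup>+s. ennreal (1 / pi * ?g s) * indicator {0<..<b - a} s \<partial>lborel)"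
    by (intro nn_integral_cong) (simp split: split_indicator)
  also have "\<dots> = ennreal (1 - ?p)" by (rule ennreal_prob_last_first[OF assms, symmetric])
  also have "enn2real \<dots> = 1 - ?p" by simp
  finally show ?thesis by simp
qed

end

section \<open>The joint density\<close>

definition joint_density :: "real \<Rightarrow> real \<Rightarrow> real \<Rightarrow> real" where
  "joint_density \<mu> a b = exp (- (\<mu>\<^sup>2 / 2) * b) / (2 * pi * sqrt (a * (b - a) ^ 3))"

text \<open>The integrand of the probability formula in the variable \<open>u = a + s\<close>: the
  density at \<open>u > a\<close> of the first zero after time \<open>a\<close>. In this variable
  \<open>a\<close> occurs only in the factor \<open>sqrt (a / (u - a))\<close>.\<close>

definition first_zero_density :: "real \<Rightarrow> real \<Rightarrow> real \<Rightarrow> real" where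
  "first_zero_density \<mu> a u = 1 / pi * (1 / u * sqrt (a / (u - a)) * exp (- (\<mu>\<^sup>2 / 2) * u))"

lemma borel_measurable_joint_density[measurable]:
  "(\<lambda>(a, b). joint_density \<mu> a b) \<in> borel_measurable (borel \<Otimes>\<^sub>M borel)"
  unfolding joint_density_def by measurable

text \<open>Differentiating \<open>sqrt (x / (u - x))\<close> gives
  \<open>u / (2 * sqrt (x * (u - x) ^ 3))\<close>; its factor \<open>u\<close> cancels the prefactor
  \<open>1 / u\<close>, and the 2 in the joint density arises here.\<close>

lemma DERIV_first_zero_density:
  assumes "0 < x" "x < u"
  shows "((\<lambda>x. first_zero_density \<mu> x u) has_real_derivative joint_density \<mu> x u) (at x)"
proof -
  define r q where "r = sqrt x" and "q = sqrt (u - x)"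
  have rq: "0 < r" "0 < q" "u - x = q * q"
    using assms by (auto simp: r_def q_def)
  have "((\<lambda>x. x / (u - x)) has_real_derivative u / ((u - x) * (u - x))) (at x)"
    using assms by (auto intro!: derivative_eq_intros)
  then have "((\<lambda>x. sqrt (x / (u - x))) has_real_derivative inverse (sqrt (x / (u - x))) / 2 * (u / ((u - x) * (u - x)))) (at x)"
    using assms by (intro DERIV_chain2[OF DERIV_real_sqrt]) auto
  then have "((\<lambda>x. first_zero_density \<mu> x u) has_real_derivative
     1 / pi * (1 / u * (inverse (sqrt (x / (u - x))) / 2 * (u / ((u - x) * (u - x)))) * exp (- (\<mu>\<^sup>2 / 2) * u))) (at x)"
    unfolding first_zero_density_def by (intro DERIV_cmult DERIV_cmult_right)
  moreover have "1 / pi * (1 / u * (inverse (sqrt (x / (u - x))) / 2 * (u / ((u - x) * (u - x)))) * exp (- (\<mu>\<^sup>2 / 2) * u))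
     = joint_density \<mu> x u"
  proof -
    have "sqrt (x * (u - x) ^ 3) = r * (q * q * q)"
      by (simp add: r_def q_def real_sqrt_mult real_sqrt_power power3_eq_cube)
    moreover have "sqrt (x / (u - x)) = r / q"
      by (simp add: r_def q_def real_sqrt_divide)
    ultimately show ?thesis
      unfolding joint_density_def rq(3)
      using rq(1,2) assms by (simp add: divide_simps)
  qed
  ultimately show ?thesis by simp
qed

lemma first_zero_density_nonneg: "0 < x \<Longrightarrow> x < u \<Longrightarrow> 0 \<le> first_zero_density \<mu> x u"
  by (simp add: first_zero_density_def)

lemma joint_density_nonneg: "0 < x \<Longrightarrow> x < u \<Longrightarrow> 0 \<le> joint_density \<mu> x u"
  by (simp add: joint_density_def)

lemma nn_integral_joint_density_fst:
  assumes "0 < p" "p \<le> q" "q < u"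
  shows "ennreal (first_zero_density \<mu> p u) + (\<integral>\<^sup>+x. ennreal (joint_density \<mu> x u) * indicator {p..<q} x \<partial>lborel) =
    ennreal (first_zero_density \<mu> q u)"
proof -
  have "(\<integral>\<^sup>+x. ennreal (joint_density \<mu> x u) * indicator {p..<q} x \<partial>lborel) =
    (\<integral>\<^sup>+x. ennreal (joint_density \<mu> x u) * indicator {p..q} x \<partial>lborel)"
    by (rule nn_integral_cong_AE, rule AE_mp[OF AE_lborel_singleton[of q]], rule AE_I2, rule impI)
       (simp split: split_indicator)
  also have "\<dots> = ennreal (first_zero_density \<mu> q u - first_zero_density \<mu> p u)"
    using assms by (intro nn_integral_FTC_Icc DERIV_first_zero_density) (auto intro: joint_density_nonneg)
  finally have eq: "(\<integral>\<^sup>+x. ennreal (joint_density \<mu> x u) * indicator {p..<q} x \<partial>lborel) =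
    ennreal (first_zero_density \<mu> q u - first_zero_density \<mu> p u)" .
  have "first_zero_density \<mu> p u \<le> first_zero_density \<mu> q u"
  proof (rule DERIV_nonneg_imp_nondecreasing[OF assms(2)])
    fix x assume "p \<le> x" "x \<le> q"
    then have "0 < x" "x < u" using assms by auto
    then show "\<exists>y. ((\<lambda>x. first_zero_density \<mu> x u) has_real_derivative y) (at x) \<and> 0 \<le> y"
      using DERIV_first_zero_density joint_density_nonneg by blast
  qed
  then show ?thesis
    unfolding eq using assms by (subst ennreal_plus[symmetric]) (auto intro: first_zero_density_nonneg)
qed

lemma nn_integral_first_zero_density:
  assumes "0 < a" "a < r" "r \<le> s"
  shows "(\<integral>\<^sup>+v. ennreal (1 / pi * (1 / (a + v) * sqrt (a / v) * exp (- (\<mu>\<^sup>2 / 2) * (a + v)))) * indicator {0<..<s - a} v \<partial>lborel) =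
    (\<integral>\<^sup>+v. ennreal (1 / pi * (1 / (a + v) * sqrt (a / v) * exp (- (\<mu>\<^sup>2 / 2) * (a + v)))) * indicator {0<..<r - a} v \<partial>lborel) +
    (\<integral>\<^sup>+u. ennreal (first_zero_density \<mu> a u) * indicator {r<..s} u \<partial>lborel)"
proof -
  let ?g = "\<lambda>v. ennreal (1 / pi * (1 / (a + v) * sqrt (a / v) * exp (- (\<mu>\<^sup>2 / 2) * (a + v))))"
  have "(\<integral>\<^sup>+v. ?g v * indicator {r - a..<s - a} v \<partial>lborel) = (\<integral>\<^sup>+u. ?g (- a + 1 * u) * indicator {r - a..<s - a} (- a + 1 * u) \<partial>lborel)"
    by (subst nn_integral_real_affine[where c = 1 and t = "- a"]) auto
  also have "\<dots> = (\<integral>\<^sup>+u. ennreal (first_zero_density \<mu> a u) * indicator {r<..s} u \<partial>lborel)"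
  proof (rule nn_integral_cong_AE, rule AE_mp[OF AE_lborel_singleton[of r]], rule AE_mp[OF AE_lborel_singleton[of s]],
      rule AE_I2, rule impI, rule impI)
    fix u assume "u \<noteq> r" "u \<noteq> s"
    then have "indicator {r - a..<s - a} (- a + 1 * u) = (indicator {r<..s} u :: ennreal)"
      by (auto simp: indicator_def)
    moreover have "?g (- a + 1 * u) = ennreal (first_zero_density \<mu> a u)"
      by (simp add: first_zero_density_def)
    ultimately show "?g (- a + 1 * u) * indicator {r - a..<s - a} (- a + 1 * u) = ennreal (first_zero_density \<mu> a u) * indicator {r<..s} u"
      by (simp only:)
  qed
  finally have *: "(\<integral>\<^sup>+v. ?g v * indicator {r - a..<s - a} v \<partial>lborel) = \<dots>" .
  have "(\<integral>\<^sup>+v. ?g v * indicator {0<..<s - a} v \<partial>lborel) =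
    (\<integral>\<^sup>+v. ?g v * indicator {0<..<r - a} v + ?g v * indicator {r - a..<s - a} v \<partial>lborel)"
  proof (intro nn_integral_cong)
    fix v
    have "indicator {0<..<s - a} v = (indicator {0<..<r - a} v + indicator {r - a..<s - a} v :: ennreal)"
      using assms by (auto simp: indicator_def)
    then show "?g v * indicator {0<..<s - a} v = ?g v * indicator {0<..<r - a} v + ?g v * indicator {r - a..<s - a} v"
      by (simp only: distrib_left)
  qed
  also have "\<dots> = (\<integral>\<^sup>+v. ?g v * indicator {0<..<r - a} v \<partial>lborel) + (\<integral>\<^sup>+v. ?g v * indicator {r - a..<s - a} v \<partial>lborel)"
    by (rule nn_integral_add) auto
  finally show ?thesis unfolding * .
qed

context standard_brownian_motion
begin

text \<open>A second difference of the joint tail \<open>E a b\<close>. The difference in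
  \<open>b\<close> is an integral of \<open>first_zero_density\<close>, and the difference in
  \<open>a\<close> turns this into an integral of its derivative. The strict inequalities in
  \<open>E\<close> dictate the shape \<open>{p..<q} \<times> {r<..s}\<close>. Degenerate rectangles
  are included because intersecting with quadrants later may produce them.\<close>

lemma emeasure_last_first_rectangle:
  assumes p: "0 < p" and q: "q < t" and r: "t < r"
  shows "emeasure M {\<omega> \<in> space M. p \<le> last_zero_before (with_drift \<mu> B) t \<omega> \<and> last_zero_before (with_drift \<mu> B) t \<omega> < q \<and>
      ereal r < first_zero_after (with_drift \<mu> B) t \<omega> \<and> first_zero_after (with_drift \<mu> B) t \<omega> \<le> ereal s} =
    (\<integral>\<^sup>+u. (\<integral>\<^sup>+x. ennreal (joint_density \<mu> x u) * indicator {p..<q} x \<partial>lborel) * indicator {r<..s} u \<partial>lborel)"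
    (is "emeasure M ?R = ?D")
proof (cases "p < q \<and> r < s")
  case False
  then consider "q \<le> p" | "s \<le> r" by linarith
  then show ?thesis
  proof cases
    case 1
    then have "?R = {}" by auto
    with 1 show ?thesis by (simp only: emeasure_empty) simp
  next
    case 2
    have "\<not> (ereal r < v \<and> v \<le> ereal s)" for v
    proof
      assume "ereal r < v \<and> v \<le> ereal s"
      then have "ereal r < ereal s" by (elim conjE) (rule less_le_trans)
      with 2 show False by simp
    qed
    then have "?R = {}" by blast
    with 2 show ?thesis by (simp only: emeasure_empty) simp
  qed
next
  case True
  then have pq: "p < q" and rs: "r < s" by auto
  have t: "0 < t" using p q pq by simp
  let ?U = "last_zero_before (with_drift \<mu> B) t" and ?V = "first_zero_after (with_drift \<mu> B) t"
  note [measurable] = measurable_last_zero_before[OF t] measurable_first_zero_after[OF t]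
  define E where "E a b = {\<omega> \<in> space M. ?U \<omega> < a \<and> ereal b < ?V \<omega>}" for a b
  have E[measurable]: "E a b \<in> sets M" for a b unfolding E_def by measurable
  let ?Q = "\<lambda>a. \<integral>\<^sup>+u. ennreal (first_zero_density \<mu> a u) * indicator {r<..s} u \<partial>lborel"
  have Q: "?Q a = ennreal (prob (E a r) - prob (E a s))" if a: "0 < a" "a < t" for a
  proof -
    have "ennreal (1 - prob (E a s)) = ennreal (1 - prob (E a r)) + ?Q a"
      unfolding E_def ennreal_prob_last_first[OF a r] ennreal_prob_last_first[OF a less_trans[OF r rs]]
      using a r rs by (intro nn_integral_first_zero_density) auto
    moreover have "prob (E a s) \<le> prob (E a r)"
      using rs by (intro finite_measure_mono E) (auto simp: E_def intro: less_trans[of "ereal r" "ereal s"])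
    then have "ennreal (1 - prob (E a s)) = ennreal (1 - prob (E a r)) + ennreal (prob (E a r) - prob (E a s))"
      by (subst ennreal_plus[symmetric]) auto
    ultimately show ?thesis
      by (simp add: ennreal_add_left_cancel)
  qed
  have "?Q q = (\<integral>\<^sup>+u. ennreal (first_zero_density \<mu> p u) * indicator {r<..s} u +
      (\<integral>\<^sup>+x. ennreal (joint_density \<mu> x u) * indicator {p..<q} x \<partial>lborel) * indicator {r<..s} u \<partial>lborel)"
  proof (intro nn_integral_cong)
    fix u :: real
    show "ennreal (first_zero_density \<mu> q u) * indicator {r<..s} u = ennreal (first_zero_density \<mu> p u) * indicator {r<..s} u +
      (\<integral>\<^sup>+x. ennreal (joint_density \<mu> x u) * indicator {p..<q} x \<partial>lborel) * indicator {r<..s} u"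
    proof (cases "u \<in> {r<..s}")
      case True
      then have "q < u" using q r by simp
      with nn_integral_joint_density_fst[OF p less_imp_le[OF pq] this, of \<mu>] True show ?thesis by simp
    qed simp
  qed
  also have "\<dots> = ?Q p + ?D"
    unfolding first_zero_density_def by (rule nn_integral_add) measurable
  finally have "ennreal (prob (E q r) - prob (E q s)) = ennreal (prob (E p r) - prob (E p s)) + ?D"
    using Q[of q] Q[of p] p q pq by simp
  moreover have "ennreal (prob (E q r) - prob (E q s)) = ennreal (prob (E p r) - prob (E p s)) + emeasure M ?R"
  proof -
    have sub: "E p s \<subseteq> E p r" "E q s \<subseteq> E q r" "E p r \<subseteq> E q r"
      using pq rs by (auto simp: E_def intro: less_trans[of "ereal r" "ereal s"])
    have "?R = (E q r - E q s) - (E p r - E p s)"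
      using pq by (auto simp: E_def not_less)
    moreover have "E p r - E p s \<subseteq> E q r - E q s"
      using pq by (auto simp: E_def)
    ultimately have "prob ?R = prob (E q r - E q s) - prob (E p r - E p s)"
      by (simp add: finite_measure_Diff)
    also have "\<dots> = (prob (E q r) - prob (E q s)) - (prob (E p r) - prob (E p s))"
      using sub by (simp add: finite_measure_Diff)
    finally have "prob (E q r) - prob (E q s) = (prob (E p r) - prob (E p s)) + prob ?R" by simp
    moreover have "prob (E p s) \<le> prob (E p r)" using sub by (intro finite_measure_mono) auto
    ultimately show ?thesis by (simp add: emeasure_eq_measure)
  qed
  ultimately show ?thesis
    by (simp add: ennreal_add_left_cancel)
qed

end

section \<open>From rectangles to Borel sets\<close>

lemma measure_eqI_Iio_Ioi:
  fixes P D :: "(real \<times> real) measure"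
  assumes sets: "sets P = sets borel" "sets D = sets borel" and fin: "emeasure P UNIV < \<infinity>"
    and eq: "\<And>a b. emeasure P ({..<a} \<times> {b<..}) = emeasure D ({..<a} \<times> {b<..})"
  shows "P = D"
proof -
  \<comment> \<open>Quadrants open to the left and upwards are stable under intersection, and they
    cut a box \<open>{p..<q} \<times> {r<..s}\<close> in a box of the same kind, where the rectangle
    formula applies.\<close>
  let ?E = "{a \<times> b |a b. a \<in> range lessThan \<and> b \<in> range greaterThan} :: (real \<times> real) set set"
  have lt: "\<Union> (range (\<lambda>n. {..<real n})) = UNIV" and gt: "\<Union> (range (\<lambda>n. {- real n<..})) = UNIV"
  proof -
    have "\<exists>n. x < real n" "\<exists>n. - real n < x" for x :: real
      using reals_Archimedean2[of x] reals_Archimedean2[of "- x"] by (auto simp: minus_less_iff)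
    then show "\<Union> (range (\<lambda>n. {..<real n})) = UNIV" "\<Union> (range (\<lambda>n. {- real n<..})) = UNIV"
      by auto
  qed
  have "sets (borel \<Otimes>\<^sub>M borel :: (real \<times> real) measure) =
      sets (sigma (space borel \<times> space borel) ?E)"
  proof (rule sets_pair_eq)
    show "sets (borel :: real measure) = sigma_sets (space borel) (range lessThan)"
      by (subst borel_Iio) simp
    show "sets (borel :: real measure) = sigma_sets (space borel) (range greaterThan)"
      by (subst borel_Ioi) simp
    show "countable (range (\<lambda>n. {..<real n}))" "range (\<lambda>n. {..<real n}) \<subseteq> range lessThan"
        "\<Union> (range (\<lambda>n. {..<real n})) = space borel"
      using lt by auto
    show "countable (range (\<lambda>n. {- real n<..}))" "range (\<lambda>n. {- real n<..}) \<subseteq> range greaterThan"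
        "\<Union> (range (\<lambda>n. {- real n<..})) = space borel"
      using gt by auto
  qed auto
  then have borel: "sets (borel :: (real \<times> real) measure) = sigma_sets UNIV ?E"
    unfolding borel_prod by simp
  show ?thesis
  proof (rule measure_eqI_generator_eq[where E = ?E and \<Omega> = UNIV and A = "\<lambda>n. {..<real n} \<times> {- real n<..}"])
    show "Int_stable ?E"
    proof (rule Int_stableI)
      fix X Y assume "X \<in> ?E" "Y \<in> ?E"
      then obtain a b c d where "X = {..<a} \<times> {b<..}" "Y = {..<c} \<times> {d<..}" by auto
      then have "X \<inter> Y = {..<min a c} \<times> {max b d<..}" by auto
      then show "X \<inter> Y \<in> ?E" by blast
    qed
    show "(\<Union>n. {..<real n} \<times> {- real n<..}) = (UNIV :: (real \<times> real) set)"
    proof -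
      have "\<exists>n. x < real n \<and> - real n < y" for x y :: real
        using reals_Archimedean2[of "max x (- y)"] by (auto simp: minus_less_iff)
      then show ?thesis by auto
    qed
    show "emeasure P ({..<real n} \<times> {- real n<..}) \<noteq> \<infinity>" for n
      using fin emeasure_mono[of "{..<real n} \<times> {- real n<..}" UNIV P] sets by (auto simp: top_unique less_top)
  qed (use sets borel eq in auto)
qed

context standard_brownian_motion
begin

text \<open>Both measures are cut down to \<open>K\<close> by an indicator density. This keeps the
  whole plane as the space, makes the measures comparable on quadrants, and confines
  \<open>joint_density\<close> to arguments where it is the intended density.\<close>

lemma emeasure_last_first_box:
  fixes p q r s :: real
  defines "K \<equiv> {p..<q} \<times> {r<..s}"
  assumes p: "0 < p" and q: "q < t" and r: "t < r" and t: "0 < t" and A: "A \<in> sets borel"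
  shows "emeasure M {\<omega> \<in> space M. \<bar>first_zero_after (with_drift \<mu> B) t \<omega>\<bar> < \<infinity> \<and>
      (last_zero_before (with_drift \<mu> B) t \<omega>, real_of_ereal (first_zero_after (with_drift \<mu> B) t \<omega>)) \<in> K \<inter> A} =
    emeasure (density lborel (\<lambda>(a, b). ennreal (joint_density \<mu> a b))) (K \<inter> A)"
proof -
  let ?U = "last_zero_before (with_drift \<mu> B) t" and ?V = "first_zero_after (with_drift \<mu> B) t"
  note [measurable] = measurable_last_zero_before[OF t] measurable_first_zero_after[OF t]
  let ?Z = "\<lambda>\<omega>. (?U \<omega>, real_of_ereal (?V \<omega>))"
  define W where "W A = {\<omega> \<in> space M. \<bar>?V \<omega>\<bar> < \<infinity> \<and> ?Z \<omega> \<in> A}" for A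
  define P where "P = distr (density M (indicator (W K))) borel ?Z"
  define D where "D = density lborel (\<lambda>(a, b). ennreal (joint_density \<mu> a b))"
  have Z: "?Z \<in> borel_measurable M"
    by (intro borel_measurable_Pair) measurable
  have jm: "(\<lambda>(a, b). ennreal (joint_density \<mu> a b)) \<in> borel_measurable borel"
    using borel_measurable_joint_density[of \<mu>] unfolding borel_prod by (simp add: case_prod_beta')
  have setsD: "sets D = sets borel" by (simp add: D_def)
  have K: "K \<in> sets borel"
    unfolding K_def by (intro borel_Times) auto
  have W: "W A \<in> sets M" if "A \<in> sets borel" for A
  proof -
    have "W A = {\<omega> \<in> space M. \<bar>?V \<omega>\<bar> < \<infinity>} \<inter> (?Z -` A \<inter> space M)" by (auto simp: W_def)
    then show ?thesis using measurable_sets[OF Z that] by simp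
  qed
  have P: "emeasure P A = emeasure M (W (K \<inter> A))" if A: "A \<in> sets borel" for A
  proof -
    have "emeasure P A = emeasure (density M (indicator (W K))) (?Z -` A \<inter> space M)"
      unfolding P_def using Z A by (subst emeasure_distr) auto
    also have "\<dots> = (\<integral>\<^sup>+\<omega>. indicator (W K) \<omega> * indicator (?Z -` A \<inter> space M) \<omega> \<partial>M)"
      using W[OF K] measurable_sets[OF Z A] by (subst emeasure_density) auto
    also have "\<dots> = (\<integral>\<^sup>+\<omega>. indicator (W (K \<inter> A)) \<omega> \<partial>M)"
      by (intro nn_integral_cong) (auto simp: W_def indicator_def)
    also have "\<dots> = emeasure M (W (K \<inter> A))" using W K A by (subst nn_integral_indicator) auto
    finally show ?thesis .
  qed
  have DK: "emeasure (density D (indicator K)) A = emeasure D (K \<inter> A)" if A: "A \<in> sets borel" for A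
  proof -
    have "emeasure (density D (indicator K)) A = (\<integral>\<^sup>+z. indicator K z * indicator A z \<partial>D)"
      using K A setsD by (subst emeasure_density) (auto simp: measurable_def)
    also have "\<dots> = (\<integral>\<^sup>+z. indicator (K \<inter> A) z \<partial>D)"
      by (intro nn_integral_cong) (auto simp: indicator_def)
    also have "\<dots> = emeasure D (K \<inter> A)" using K A setsD by (subst nn_integral_indicator) auto
    finally show ?thesis .
  qed
  have "P = density D (indicator K)"
  proof (rule measure_eqI_Iio_Ioi)
    show "sets P = sets borel" "sets (density D (indicator K)) = sets borel"
      by (simp_all add: P_def setsD)
    have "emeasure P UNIV \<le> 1"
      using P[of UNIV] W[OF K] by (simp add: emeasure_eq_measure)
    then show "emeasure P UNIV < \<infinity>" using le_less_trans by fastforce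
    fix a b
    have rect: "{..<a} \<times> {b<..} \<in> sets (borel :: (real \<times> real) measure)"
      by (intro borel_Times) auto
    let ?q = "min q a" and ?r = "max r b"
    have KAB: "K \<inter> ({..<a} \<times> {b<..}) = {p..<?q} \<times> {?r<..s}"
      unfolding K_def by auto
    \<comment> \<open>\<open>real_of_ereal\<close> sends infinite values to 0, so finiteness is part
      of the event on the left; on the right the real bounds already enforce it.\<close>
    have "\<bar>v\<bar> < \<infinity> \<and> real_of_ereal v \<in> {?r<..s} \<longleftrightarrow> ereal ?r < v \<and> v \<le> ereal s" for v
      by (cases v) auto
    then have "W ({p..<?q} \<times> {?r<..s}) = {\<omega> \<in> space M. p \<le> ?U \<omega> \<and> ?U \<omega> < ?q \<and> ereal ?r < ?V \<omega> \<and> ?V \<omega> \<le> ereal s}"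
      unfolding W_def mem_Times_iff fst_conv snd_conv atLeastLessThan_iff by blast
    then have "emeasure P ({..<a} \<times> {b<..}) =
        (\<integral>\<^sup>+u. (\<integral>\<^sup>+x. ennreal (joint_density \<mu> x u) * indicator {p..<?q} x \<partial>lborel) * indicator {?r<..s} u \<partial>lborel)"
      unfolding P[OF rect] KAB using p q r by (simp only:) (intro emeasure_last_first_rectangle, auto)
    also have "\<dots> = (\<integral>\<^sup>+u. (\<integral>\<^sup>+x. ennreal (joint_density \<mu> x u) * indicator ({p..<?q} \<times> {?r<..s}) (x, u) \<partial>lborel) \<partial>lborel)"
    proof (intro nn_integral_cong)
      fix u :: real
      have "(\<integral>\<^sup>+x. ennreal (joint_density \<mu> x u) * indicator {p..<?q} x \<partial>lborel) * indicator {?r<..s} u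
        = (\<integral>\<^sup>+x. ennreal (joint_density \<mu> x u) * indicator {p..<?q} x * indicator {?r<..s} u \<partial>lborel)"
        by (subst nn_integral_multc) auto
      also have "\<dots> = (\<integral>\<^sup>+x. ennreal (joint_density \<mu> x u) * indicator ({p..<?q} \<times> {?r<..s}) (x, u) \<partial>lborel)"
        by (simp only: mult.assoc indicator_times fst_conv snd_conv)
      finally show "(\<integral>\<^sup>+x. ennreal (joint_density \<mu> x u) * indicator {p..<?q} x \<partial>lborel) * indicator {?r<..s} u = \<dots>" .
    qed
    also have "\<dots> = (\<integral>\<^sup>+z. (\<lambda>(a, b). ennreal (joint_density \<mu> a b)) z * indicator ({p..<?q} \<times> {?r<..s}) z \<partial>(lborel \<Otimes>\<^sub>M lborel))"
      by (subst lborel_pair.nn_integral_snd[symmetric]) auto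
    also have "\<dots> = emeasure D ({p..<?q} \<times> {?r<..s})"
      unfolding D_def lborel_prod using jm by (subst emeasure_density) (auto intro!: borel_Times)
    also have "\<dots> = emeasure (density D (indicator K)) ({..<a} \<times> {b<..})"
      unfolding DK[OF rect] KAB ..
    finally show "emeasure P ({..<a} \<times> {b<..}) = emeasure (density D (indicator K)) ({..<a} \<times> {b<..})" .
  qed
  then show ?thesis
    using P[OF A] DK[OF A] by (simp add: W_def D_def)
qed

text \<open>The box formula requires a positive distance from the lines \<open>a = 0\<close>,
  \<open>a = t\<close> and \<open>b = t\<close>. The region is therefore exhausted by increasing
  boxes, and continuity from below carries the identity to every Borel subset.\<close>

lemma has_joint_density_last_first:
  assumes t: "0 < t"
  shows "has_joint_density_on M (last_zero_before (with_drift \<mu> B) t) (first_zero_after (with_drift \<mu> B) t)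
    {(a, b). 0 < a \<and> a < t \<and> t < b} (joint_density \<mu>)"
proof -
  let ?U = "last_zero_before (with_drift \<mu> B) t" and ?V = "first_zero_after (with_drift \<mu> B) t"
  let ?R = "{(a, b). 0 < a \<and> a < t \<and> t < b}"
  note [measurable] = measurable_last_zero_before[OF t] measurable_first_zero_after[OF t]
  let ?Z = "\<lambda>\<omega>. (?U \<omega>, real_of_ereal (?V \<omega>))"
  define W where "W A = {\<omega> \<in> space M. \<bar>?V \<omega>\<bar> < \<infinity> \<and> ?Z \<omega> \<in> A}" for A
  define D where "D = density lborel (\<lambda>(a, b). ennreal (joint_density \<mu> a b))"
  have Z: "?Z \<in> borel_measurable M"
    by (intro borel_measurable_Pair) measurable
  have jm: "(\<lambda>(a, b). joint_density \<mu> a b) \<in> borel_measurable borel"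
    using borel_measurable_joint_density[of \<mu>] unfolding borel_prod .
  then have jm': "(\<lambda>(a, b). ennreal (joint_density \<mu> a b)) \<in> borel_measurable borel"
    by (simp add: case_prod_beta')
  have main: "emeasure M (W A) = emeasure D A" if A: "A \<in> sets borel" "A \<subseteq> ?R" for A
  proof -
    \<comment> \<open>The margins \<open>1 / real (Suc n)\<close> provide the strict bounds of the
      box formula, and the upper end \<open>real n\<close> keeps the boxes bounded; empty boxes for
      small \<open>n\<close> do no harm.\<close>
    define K where "K n = {1 / real (Suc n)..<t - 1 / real (Suc n)} \<times> {t + 1 / real (Suc n)<..real n}" for n
    have Kb: "K n \<in> sets borel" for n unfolding K_def by (intro borel_Times) auto
    have inc: "incseq K"
    proof (rule incseq_SucI)
      fix n
      have "1 / real (Suc (Suc n)) \<le> 1 / real (Suc n)" by (simp add: frac_le)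
      then show "K n \<subseteq> K (Suc n)" unfolding K_def by (intro Sigma_mono) auto
    qed
    have ex: "\<exists>n. z \<in> K n" if "z \<in> ?R" for z
    proof -
      obtain a b where z: "z = (a, b)" and ab: "0 < a" "a < t" "t < b" using \<open>z \<in> ?R\<close> by auto
      have "(\<lambda>n. 1 / real (Suc n)) \<longlonglongrightarrow> 0" by real_asymp
      moreover have "0 < min a (min (t - a) (b - t))" using ab by simp
      ultimately have "\<forall>\<^sub>F n in sequentially. 1 / real (Suc n) < min a (min (t - a) (b - t))"
        by (rule order_tendstoD)
      moreover have "\<forall>\<^sub>F n in sequentially. b \<le> real n"
        by real_asymp
      ultimately have "\<forall>\<^sub>F n in sequentially. z \<in> K n"
        by eventually_elim (auto simp: K_def z)
      then show ?thesis by (rule eventually_happens'[OF sequentially_bot])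
    qed
    have A_eq: "A = (\<Union>n. K n \<inter> A)"
    proof
      show "A \<subseteq> (\<Union>n. K n \<inter> A)"
      proof
        fix z assume "z \<in> A"
        moreover from this obtain n where "z \<in> K n" using ex subsetD[OF A(2)] by blast
        ultimately show "z \<in> (\<Union>n. K n \<inter> A)" by blast
      qed
    qed blast
    have "W (K n \<inter> A) \<in> sets M" for n
    proof -
      have "W (K n \<inter> A) = {\<omega> \<in> space M. \<bar>?V \<omega>\<bar> < \<infinity>} \<inter> (?Z -` (K n \<inter> A) \<inter> space M)" by (auto simp: W_def)
      then show ?thesis using measurable_sets[OF Z, of "K n \<inter> A"] Kb A by simp
    qed
    moreover have "incseq (\<lambda>n. W (K n \<inter> A))"
      using inc by (fastforce simp: incseq_def W_def)
    ultimately have "(\<lambda>n. emeasure M (W (K n \<inter> A))) \<longlonglongrightarrow> emeasure M (\<Union>n. W (K n \<inter> A))"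
      by (intro Lim_emeasure_incseq) auto
    also have "(\<Union>n. W (K n \<inter> A)) = W (\<Union>n. K n \<inter> A)" by (auto simp: W_def)
    also have "\<dots> = W A" unfolding A_eq[symmetric] ..
    finally have limM: "(\<lambda>n. emeasure M (W (K n \<inter> A))) \<longlonglongrightarrow> emeasure M (W A)" .
    have "(\<lambda>n. emeasure D (K n \<inter> A)) \<longlonglongrightarrow> emeasure D (\<Union>n. K n \<inter> A)"
      using inc Kb A by (intro Lim_emeasure_incseq) (auto simp: D_def incseq_def)
    then have "(\<lambda>n. emeasure D (K n \<inter> A)) \<longlonglongrightarrow> emeasure D A" unfolding A_eq[symmetric] .
    moreover have "emeasure M (W (K n \<inter> A)) = emeasure D (K n \<inter> A)" for n
      unfolding W_def D_def K_def by (intro emeasure_last_first_box A t) auto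
    ultimately show ?thesis using limM LIMSEQ_unique by simp
  qed
  show ?thesis
    unfolding has_joint_density_on_def
  proof (intro conjI ballI impI)
    show "(\<lambda>(x, y). joint_density \<mu> x y) \<in> borel_measurable (restrict_space borel ?R)"
      by (rule measurable_restrict_space1[OF jm])
    show "case z of (x, y) \<Rightarrow> 0 \<le> joint_density \<mu> x y" if "z \<in> ?R" for z
      using that by (auto intro: joint_density_nonneg)
    show "emeasure M {\<omega> \<in> space M. \<bar>?V \<omega>\<bar> < \<infinity> \<and> (?U \<omega>, real_of_ereal (?V \<omega>)) \<in> A} =
        (\<integral>\<^sup>+(x, y)\<in>A. ennreal (joint_density \<mu> x y) \<partial>lborel)" if "A \<in> sets borel" "A \<subseteq> ?R" for A
    proof -
      have "emeasure D A = (\<integral>\<^sup>+(x, y)\<in>A. ennreal (joint_density \<mu> x y) \<partial>lborel)"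
        unfolding D_def using jm' that by (subst emeasure_density) (auto simp: case_prod_beta')
      then show ?thesis using main[OF that] by (simp add: W_def)
    qed
  qed measurable
qed

end

theorem theorem3p1:
  fixes M :: "'a measure" and B :: "real \<Rightarrow> 'a \<Rightarrow> real" and \<mu> t :: real
  assumes "standard_brownian_motion M B"
    and "t > 0"
  shows "(\<forall>a b. 0 < a \<and> a < t \<and> t < b \<longrightarrow>
            measure M {\<omega> \<in> space M. last_zero_before (with_drift \<mu> B) t \<omega> < a \<and>
                                  first_zero_after (with_drift \<mu> B) t \<omega> > ereal b} =
            1 - 1 / pi * (LBINT s:{0<..<b - a}.
                  1 / (a + s) * sqrt (a / s) * exp (- (\<mu>\<^sup>2 / 2) * (a + s)))) \<and>
         has_joint_density_on M
           (last_zero_before (with_drift \<mu> B) t) (first_zero_after (with_drift \<mu> B) t)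
           {(a, b). 0 < a \<and> a < t \<and> t < b}
           (\<lambda>a b. exp (- (\<mu>\<^sup>2 / 2) * b) / (2 * pi * sqrt (a * (b - a) ^ 3)))"
proof -
  interpret standard_brownian_motion M B by fact
  show ?thesis
    using prob_last_first_eq[of _ t _ \<mu>] has_joint_density_last_first[OF assms(2), of \<mu>]
    unfolding joint_density_def[abs_def] by blast
qed

end
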